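(* Let $n\geq 3$ and let $G=\mathrm{D}_{2n}=\langle a,b\mid a^n=b^2=1,\ b^{-1}ab=a^{-1}\rangle$ be the dihedral group of order $2n$. (1) Suppose $G$ has the $m$-DCI property for some integer $m$ with $1\leq m\leq n-1$. Then $n$ is odd; and if moreover $p+1\leq m\leq n-1$ for some prime divisor $p$ of $n$, then a Sylow $p$-subgroup $G_p$ of $G$ is isomorphic to $\mathbb{Z}_p$ (the cyclic group of order $p$). (2) Suppose $n$ is a power of a prime $q$, and let $1\leq m\leq n-1$. Then $G$ has the $m$-DCI property if and only if $q$ is odd and either $n=q$ or $1\leq m\leq q$.
   Context: All groups and digraphs are finite. For a group $G$ and a subset $S\subseteq G$ with $1\notin S$, the Cayley digraph $\mathrm{Cay}(G,S)$ has vertex set $G$ and arc set $\{(g,sg)\mid g\in G,\ s\in S\}$; its out-valency is $|S|$. The subset $S$ (and the digraph $\mathrm{Cay}(G,S)$) is called a CI-subset (CI-digraph) if for every subset $T\subseteq G$ with $1\notin T$ such that $\mathrm{Cay}(G,T)\cong\mathrm{Cay}(G,S)$ as digraphs, there is a group automorphism $\alpha\in\mathrm{Aut}(G)$ with $S^\alpha=T$. For a positive integer $m$, $G$ has the $m$-DCI property if every Cayley digraph $\mathrm{Cay}(G,S)$ of $G$ with $|S|=m$ is a CI-digraph. *)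

theory Defs
  imports "HOL-Algebra.Algebra" "HOL-Computational_Algebra.Primes"
begin

text \<open>The dihedral group D_{2n} of order 2n, concretely: the pair (i,e) with
  i < n, e < 2 stands for the element a^i b^e, where a has order n, b has order 2
  and b^{-1} a b = a^{-1}.  Hence (a^i b^e)(a^j b^f) = a^(i + (-1)^e j) b^(e+f).\<close>
definition dihedral :: "nat \<Rightarrow> (nat \<times> nat) monoid" where
  "dihedral n = \<lparr> partial_object.carrier = {0..<n} \<times> {0..<2},
     monoid.mult = (\<lambda>(i, e) (j, f).
               ((if e = 0 then i + j else i + n - j) mod n, (e + f) mod 2)),
     monoid.one = (0, 0) \<rparr>"

definition cay_arcs :: "('a, 'b) monoid_scheme \<Rightarrow> 'a set \<Rightarrow> ('a \<times> 'a) set" where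
  "cay_arcs G S = {(g, s \<otimes>\<^bsub>G\<^esub> g) | g s. g \<in> carrier G \<and> s \<in> S}"

definition cay_iso :: "('a, 'b) monoid_scheme \<Rightarrow> 'a set \<Rightarrow> 'a set \<Rightarrow> bool" where
  "cay_iso G S T \<longleftrightarrow> (\<exists>f. bij_betw f (carrier G) (carrier G) \<and>
      (\<forall>x \<in> carrier G. \<forall>y \<in> carrier G.
          (x, y) \<in> cay_arcs G S \<longleftrightarrow> (f x, f y) \<in> cay_arcs G T))"

definition conn_set :: "('a, 'b) monoid_scheme \<Rightarrow> 'a set \<Rightarrow> bool" where
  "conn_set G S \<longleftrightarrow> S \<subseteq> carrier G \<and> \<one>\<^bsub>G\<^esub> \<notin> S"

definition CI_subset :: "('a, 'b) monoid_scheme \<Rightarrow> 'a set \<Rightarrow> bool" where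
  "CI_subset G S \<longleftrightarrow> (\<forall>T. conn_set G T \<and> cay_iso G S T \<longrightarrow>
      (\<exists>\<alpha> \<in> iso G G. \<alpha> ` S = T))"

definition has_DCI :: "('a, 'b) monoid_scheme \<Rightarrow> nat \<Rightarrow> bool" where
  "has_DCI G m \<longleftrightarrow> (\<forall>S. conn_set G S \<and> card S = m \<longrightarrow> CI_subset G S)"

definition sylow_subgroup :: "('a, 'b) monoid_scheme \<Rightarrow> nat \<Rightarrow> 'a set \<Rightarrow> bool" where
  "sylow_subgroup G p P \<longleftrightarrow> subgroup P G \<and> card P = p ^ multiplicity p (order G)"

end

theory Submission
  imports Defs "HOL-Number_Theory.Residues" "HOL-Combinatorics.Permutations"
begin

text \<open>For the negative part, automorphisms of the dihedral group map rotations to rotations by a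
  multiplier. If \<open>n\<close> is even, some circulant digraph is also a Cayley digraph of a dihedral
  subgroup, which involves reflections. If \<open>p\<^sup>2\<close> divides \<open>n\<close>, a generalized wreath product
  structure over the subgroup \<open>Q\<close> of order \<open>p\<close> yields an isomorphism that inverts \<open>Q\<close> but fixes
  the coset \<open>aQ\<close>.

  For the positive part (\<open>n = q\<^sup>k\<close>, \<open>|S| \<le> q\<close>), restrict to the component \<open>H = \<langle>S\<rangle>\<close>; let \<open>C\<close> be the
  group of rotations in \<open>H\<close> and \<open>A\<close> the automorphism group of the component. If \<open>C\<close> is a Sylow
  \<open>q\<close>-subgroup of \<open>A\<close>, an isomorphism can be adjusted within \<open>A\<close> to normalize \<open>C\<close>, and such a map
  fixing 1 is a group automorphism. Otherwise the normalizer of \<open>C\<close> in \<open>A\<close> contains an element of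
  order \<open>q\<close> fixing 1; it acts on each \<open>C\<close>-orbit as an affine map \<open>x \<mapsto> r x + s\<close>, and
  \<open>1 + r + \<dots> + r\<^bsup>q-1\<^esup>\<close> is \<open>q\<close> times a unit as \<open>q\<close> is odd, so all its orbits lie in cosets of the
  subgroup \<open>Q\<close> of order \<open>q\<close>. Since \<open>|S| \<le> q\<close>, this forces \<open>S\<close> to be a coset of \<open>Q\<close>.\<close>

section \<open>The dihedral group\<close>

text \<open>Arcs are \<open>(g, s g)\<close>, so right translations are automorphisms, and the
  classical CI criterion conjugates regular copies of the group inside the automorphism group. A
  dihedral group is not a \<open>q\<close>-group, so Sylow theory is applied to the rotation part
  \<open>C\<close> alone, which has index at most 2 in \<open>H\<close>. Reflections then come for
  free: a bijection that permutes the translations by \<open>C\<close> multiplies exponents by one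
  fixed \<open>r\<close> on each coset of \<open>C\<close>, and there are at most two cosets. The
  same index 2 enters the count producing an element of order \<open>q\<close> in the stabilizer of
  1 as a factor that an odd \<open>q\<close> ignores. The bound on \<open>|S|\<close> acts as
  follows. A nontrivial automorphism of order \<open>q\<close> fixing 1 fixes some vertex but moves
  one of its out-neighbours; the orbit of the latter consists of \<open>q\<close> out-neighbours of
  the same vertex and so exhausts them. This case does occur and is settled directly: cosets of
  \<open>Q\<close> with isomorphic digraphs are matched by an explicit automorphism. The bound is
  sharp once \<open>p\<close> squared divides \<open>n\<close>: with \<open>p + 1\<close> elements
  there is room for a single element of \<open>Q\<close> beside the whole coset
  \<open>aQ\<close>.\<close>

locale dih =
  fixes n :: nat
  assumes n_ge_3: "n \<ge> 3"
begin

abbreviation "G \<equiv> dihedral n"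

text \<open>Integer exponents of \<open>a\<close> leave signs unrestricted: inversion and
  conjugation become negation, and equality becomes divisibility by \<open>n\<close>.\<close>

definition rot :: "int \<Rightarrow> nat \<times> nat" where "rot x = (nat (x mod int n), 0)"
definition refl :: "int \<Rightarrow> nat \<times> nat" where "refl x = (nat (x mod int n), 1)"

lemma n_pos: "int n > 0" using n_ge_3 by simp

lemma rot_eq_iff: "rot x = rot y \<longleftrightarrow> int n dvd x - y"
  using n_pos by (simp add: rot_def nat_eq_iff2 mod_eq_dvd_iff dvd_diff_commute)

lemma refl_eq_iff: "refl x = refl y \<longleftrightarrow> int n dvd x - y"
  using n_pos by (simp add: refl_def nat_eq_iff2 mod_eq_dvd_iff dvd_diff_commute)

lemma rot_neq_refl [simp]: "rot x \<noteq> refl y" "refl y \<noteq> rot x"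
  by (simp_all add: rot_def refl_def)

lemma rot_in_carrier [simp]: "rot x \<in> carrier G"
  and refl_in_carrier [simp]: "refl x \<in> carrier G"
  using n_pos by (auto simp: rot_def refl_def dihedral_def nat_less_iff)

lemma rot_nat: "i < n \<Longrightarrow> (i, 0) = rot (int i)"
  and refl_nat: "i < n \<Longrightarrow> (i, Suc 0) = refl (int i)"
  by (simp_all add: rot_def refl_def)

lemma dihedral_cases:
  assumes "g \<in> carrier G"
  obtains (rot) x where "g = rot x" | (refl) x where "g = refl x"
proof -
  obtain i e where g: "g = (i, e)" "i < n" "e < 2"
    using assms by (auto simp: dihedral_def)
  then have "e = 0 \<or> e = Suc 0" by auto
  then show thesis
    using that g rot_nat refl_nat by metis
qed

lemma carrier_dihedral: "carrier G = range rot \<union> range refl"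
  by (auto elim: dihedral_cases)

lemma nat_add_mod: "(nat (x mod int n) + nat (y mod int n)) mod n = nat ((x + y) mod int n)"
proof -
  have "int ((nat (x mod int n) + nat (y mod int n)) mod n) = (x + y) mod int n"
    using n_pos by (simp add: zmod_int mod_add_eq)
  then show ?thesis by linarith
qed

lemma nat_diff_mod: "(nat (x mod int n) + n - nat (y mod int n)) mod n = nat ((x - y) mod int n)"
proof -
  have le: "nat (y mod int n) \<le> n"
    using n_pos by (simp add: nat_le_iff less_imp_le)
  have "int ((nat (x mod int n) + n - nat (y mod int n)) mod n)
      = (x mod int n + int n - y mod int n) mod int n"
    using n_pos le by (simp add: zmod_int of_nat_diff)
  also have "\<dots> = (x mod int n - y mod int n + int n) mod int n"
    by (simp add: algebra_simps)
  also have "\<dots> = (x - y) mod int n"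
    by (simp add: mod_diff_eq)
  finally show ?thesis by linarith
qed

lemma dihedral_mult [simp]:
  "rot x \<otimes>\<^bsub>G\<^esub> rot y = rot (x + y)"
  "rot x \<otimes>\<^bsub>G\<^esub> refl y = refl (x + y)"
  "refl x \<otimes>\<^bsub>G\<^esub> rot y = refl (x - y)"
  "refl x \<otimes>\<^bsub>G\<^esub> refl y = rot (x - y)"
  by (simp_all add: rot_def refl_def dihedral_def nat_add_mod nat_diff_mod)

lemma dihedral_one: "\<one>\<^bsub>G\<^esub> = rot 0"
  by (simp add: rot_def dihedral_def)

lemma group_dihedral: "group G"
proof (rule groupI)
  show "\<exists>y\<in>carrier G. y \<otimes>\<^bsub>G\<^esub> x = \<one>\<^bsub>G\<^esub>" if "x \<in> carrier G" for x
    using that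
  proof (cases x rule: dihedral_cases)
    case (rot u) then show ?thesis by (intro bexI[of _ "rot (-u)"]) (auto simp: dihedral_one)
  next
    case (refl u) then show ?thesis by (intro bexI[of _ "refl u"]) (auto simp: dihedral_one)
  qed
qed (auto simp: carrier_dihedral dihedral_one algebra_simps)

sublocale group G by (rule group_dihedral)

lemma finite_dihedral: "finite (carrier G)"
  by (simp add: dihedral_def)

lemma order_dihedral: "order G = 2 * n"
  by (simp add: dihedral_def order_def)

lemma dihedral_inv [simp]: "inv\<^bsub>G\<^esub> rot x = rot (- x)" "inv\<^bsub>G\<^esub> refl x = refl x"
  by (rule inv_equality; simp add: dihedral_one)+

text \<open>The image of \<open>rot 1\<close> cannot be a reflection: reflections are involutions,
  while \<open>rot 1\<close> has order \<open>n\<close>, at least 3. Powers of the generator then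
  inherit its multiplier.\<close>

lemma iso_rot:
  assumes "\<alpha> \<in> iso G G"
  obtains v where "\<And>x. \<alpha> (rot x) = rot (v * x)"
proof -
  interpret \<alpha>: group_hom G G \<alpha>
    using assms group_dihedral by (simp add: group_hom_def group_hom_axioms_def iso_def)
  have inj: "inj_on \<alpha> (carrier G)" using assms by (auto simp: iso_def bij_betw_def)
  have "\<exists>v. \<alpha> (rot 1) = rot v"
  proof (rule ccontr)
    assume "\<nexists>v. \<alpha> (rot 1) = rot v"
    then obtain u where u: "\<alpha> (rot 1) = refl u"
      by (metis \<alpha>.hom_closed dihedral_cases rot_in_carrier)
    have "\<alpha> (rot 2) = \<alpha> (rot 1 \<otimes>\<^bsub>G\<^esub> rot 1)" by simp
    also have "\<dots> = rot 0" using u by (simp only: \<alpha>.hom_mult rot_in_carrier) simp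
    also have "\<dots> = \<alpha> (rot 0)" using \<alpha>.hom_one by (simp add: dihedral_one)
    finally have "rot 2 = rot 0" using inj by (simp add: inj_on_eq_iff)
    then show False using n_ge_3 zdvd_imp_le[of "int n" 2] by (simp add: rot_eq_iff)
  qed
  then obtain v where v: "\<alpha> (rot 1) = rot v" ..
  have nat: "\<alpha> (rot (int i)) = rot (v * int i)" for i
  proof (induction i)
    case 0 then show ?case using \<alpha>.hom_one by (simp add: dihedral_one)
  next
    case (Suc i)
    have "\<alpha> (rot (int (Suc i))) = \<alpha> (rot 1 \<otimes>\<^bsub>G\<^esub> rot (int i))" by simp
    also have "\<dots> = rot (v * int (Suc i))"
      using v Suc.IH by (simp only: \<alpha>.hom_mult rot_in_carrier) (simp add: algebra_simps)
    finally show ?case .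
  qed
  have "\<alpha> (rot x) = rot (v * x)" for x
  proof -
    have "rot x = rot (int (nat (x mod int n)))"
      using n_pos by (simp add: rot_eq_iff mod_eq_dvd_iff[symmetric])
    then have "\<alpha> (rot x) = rot (v * (x mod int n))"
      using nat[of "nat (x mod int n)"] n_pos by simp
    also have "\<dots> = rot (v * x)"
      by (simp add: rot_eq_iff mod_eq_dvd_iff[symmetric] mod_mult_right_eq)
    finally show ?thesis .
  qed
  then show thesis using that by blast
qed

text \<open>For \<open>u\<close> prime to \<open>n\<close>, the automorphism with a -> a^u and b ->
  a^v b.\<close>

definition affine :: "int \<Rightarrow> int \<Rightarrow> nat \<times> nat \<Rightarrow> nat \<times> nat" where
  "affine u v g = (if snd g = 0 then rot (u * int (fst g)) else refl (u * int (fst g) + v))"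

lemma affine_rot [simp]: "affine u v (rot x) = rot (u * x)"
  and affine_refl [simp]: "affine u v (refl x) = refl (u * x + v)"
proof -
  have "int n dvd u * (x mod int n) - u * x"
    by (simp add: mod_eq_dvd_iff[symmetric] mod_mult_right_eq)
  then show "affine u v (rot x) = rot (u * x)" "affine u v (refl x) = refl (u * x + v)"
    using n_pos by (auto simp: affine_def rot_def[of x] refl_def[of x] rot_eq_iff refl_eq_iff)
qed

lemma affine_iso:
  assumes "coprime u (int n)"
  shows "affine u v \<in> iso G G"
proof (rule isoI)
  show "affine u v \<in> hom G G"
    by (rule homI) (auto simp: carrier_dihedral algebra_simps)
  have "inj_on (affine u v) (carrier G)"
  proof (rule inj_onI)
    have dvd: "int n dvd x - y" if "int n dvd u * x - u * y" for x y
      using that assms by (simp add: right_diff_distrib[symmetric] coprime_dvd_mult_right_iff coprime_commute)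
    show "x = y" if "x \<in> carrier G" "y \<in> carrier G" "affine u v x = affine u v y" for x y
      using that dvd by (auto simp: carrier_dihedral rot_eq_iff refl_eq_iff)
  qed
  then show "bij_betw (affine u v) (carrier G) (carrier G)"
    using finite_dihedral
    by (metis \<open>affine u v \<in> hom G G\<close> bij_betw_def endo_inj_surj hom_carrier)
qed

end

section \<open>Non-CI subsets for even n\<close>

text \<open>One direction of arc preservation suffices because both digraphs have equally many arcs.\<close>

lemma (in group) cay_isoI:
  assumes fin: "finite (carrier G)" and S: "S \<subseteq> carrier G" and T: "T \<subseteq> carrier G"
    and card: "card S = card T" and f: "bij_betw f (carrier G) (carrier G)"
    and step: "\<And>g s. g \<in> carrier G \<Longrightarrow> s \<in> S \<Longrightarrow> \<exists>t\<in>T. f (s \<otimes> g) = t \<otimes> f g"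
  shows "cay_iso G S T"
proof -
  have arcs: "cay_arcs G U = (\<lambda>(g, s). (g, s \<otimes> g)) ` (carrier G \<times> U)" for U
    by (auto simp: cay_arcs_def)
  have card_arcs: "card (cay_arcs G U) = card (carrier G) * card U" if "U \<subseteq> carrier G" for U
    unfolding arcs using that
    by (subst card_image) (auto simp: inj_on_def card_cartesian_product subset_iff)
  have fin_arcs: "finite (cay_arcs G T)"
    unfolding arcs using fin finite_subset[OF T] by simp
  have sub: "map_prod f f ` cay_arcs G S \<subseteq> cay_arcs G T"
  proof
    fix e assume "e \<in> map_prod f f ` cay_arcs G S"
    then obtain g s where e: "e = (f g, f (s \<otimes> g))" "g \<in> carrier G" "s \<in> S"
      by (auto simp: cay_arcs_def)
    then obtain t where "t \<in> T" "f (s \<otimes> g) = t \<otimes> f g" using step by blast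
    then show "e \<in> cay_arcs G T"
      using e bij_betwE[OF f] by (auto simp: cay_arcs_def)
  qed
  have subG: "cay_arcs G S \<subseteq> carrier G \<times> carrier G"
    using S by (auto simp: cay_arcs_def)
  have inj: "inj_on (map_prod f f) (carrier G \<times> carrier G)"
    using f by (auto simp: bij_betw_def intro: map_prod_inj_on)
  have "card (map_prod f f ` cay_arcs G S) = card (cay_arcs G T)"
    using card_image[OF inj_on_subset[OF inj subG]] card_arcs[OF S] card_arcs[OF T] card by simp
  then have eq: "map_prod f f ` cay_arcs G S = cay_arcs G T"
    using card_subset_eq[OF fin_arcs sub] by simp
  have "(x, y) \<in> cay_arcs G S \<longleftrightarrow> (f x, f y) \<in> cay_arcs G T"
    if "x \<in> carrier G" "y \<in> carrier G" for x y
  proof -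
    have "(x, y) \<in> cay_arcs G S \<longleftrightarrow> map_prod f f (x, y) \<in> map_prod f f ` cay_arcs G S"
      using inj_on_image_mem_iff[OF inj, of "(x, y)" "cay_arcs G S"] subG that by simp
    then show ?thesis using eq by simp
  qed
  then show ?thesis using f by (auto simp: cay_iso_def)
qed

context dih begin

lemma conn_setI: "S \<subseteq> carrier G \<Longrightarrow> rot 0 \<notin> S \<Longrightarrow> conn_set G S"
  by (simp add: conn_set_def dihedral_one)

lemma not_CI_if_refl:
  assumes "refl y \<in> T" "conn_set G T" "S \<subseteq> range rot" "cay_iso G S T"
  shows "\<not> CI_subset G S"
proof
  assume "CI_subset G S"
  then obtain \<alpha> where \<alpha>: "\<alpha> \<in> iso G G" "\<alpha> ` S = T"
    using assms by (auto simp: CI_subset_def)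
  obtain v where "\<And>x. \<alpha> (rot x) = rot (v * x)" using iso_rot[OF \<alpha>(1)] by blast
  then show False using \<alpha>(2) assms(1,3) by auto
qed

lemma bij_if_inj:
  assumes "f ` carrier G \<subseteq> carrier G" "inj_on f (carrier G)"
  shows "bij_betw f (carrier G) (carrier G)"
  using assms finite_dihedral by (simp add: bij_betw_def endo_inj_surj)

text \<open>The central involution against a reflection: both Cayley digraphs are perfect matchings.\<close>

lemma even_not_1_DCI:
  assumes "even n"
  shows "\<not> has_DCI G 1"
proof -
  define l where "l = int (n div 2)"
  have l: "int n = 2 * l" "l \<ge> 2"
    using assms n_ge_3 unfolding l_def by (auto elim: evenE)
  \<comment> \<open>The pairs \<open>{x, x + l}\<close> in the two cosets of the rotation group are
    numbered by \<open>u = x + e * l\<close> with \<open>x < l\<close>, so \<open>u\<close> runs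
    through all residues below \<open>2 * l\<close>. Pair \<open>u\<close> goes to the edge from
    \<open>rot u\<close> to \<open>refl (- u)\<close> of the second matching.\<close>
  define f where "f g = (if int (fst g) < l then rot (int (fst g) + int (snd g) * l)
    else refl (- (int (fst g) - l + int (snd g) * l)))" for g :: "nat \<times> nat"
  have carr: "carrier G = {0..<n} \<times> {0..<2}" by (simp add: dihedral_def)
  have inj: "inj_on f (carrier G)"
  proof (rule inj_onI)
    fix g h assume gh: "g \<in> carrier G" "h \<in> carrier G" "f g = f h"
    obtain x d y e where xy: "g = (x, d)" "h = (y, e)" "int x < 2 * l" "int y < 2 * l"
      "d = 0 \<or> d = 1" "e = 0 \<or> e = 1"
      using gh carr l(1) by (auto simp: numeral_2_eq_2 less_Suc_eq)
    have *: "u = v" if "0 \<le> u" "u < 2 * l" "0 \<le> v" "v < 2 * l" "2 * l dvd u - v" for u v :: int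
      using that by (metis mod_eq_dvd_iff mod_pos_pos_trivial)
    show "g = h"
    proof (cases "int x < l")
      case True
      then have "int y < l" using gh xy by (auto simp: f_def split: if_splits)
      with True have "2 * l dvd (int x + int d * l) - (int y + int e * l)"
        using gh xy l(1) by (auto simp: f_def rot_eq_iff)
      then have "int x + int d * l = int y + int e * l"
        using True \<open>int y < l\<close> xy by (intro *) auto
      then show ?thesis using True \<open>int y < l\<close> xy by auto
    next
      case False
      then have y: "\<not> int y < l" using gh xy by (auto simp: f_def split: if_splits)
      with False have "2 * l dvd - (int x - l + int d * l) - - (int y - l + int e * l)"
        using gh xy l(1) by (auto simp: f_def refl_eq_iff)
      then have "2 * l dvd (int y - l + int e * l) - (int x - l + int d * l)"
        by (simp add: algebra_simps)
      then have "int y - l + int e * l = int x - l + int d * l"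
        using False y xy by (intro *) auto
      then show ?thesis using False y xy by auto
    qed
  qed
  have iso: "cay_iso G {rot l} {refl 0}"
  proof (rule cay_isoI[OF finite_dihedral])
    show "bij_betw f (carrier G) (carrier G)"
      using inj by (intro bij_if_inj) (auto simp: f_def)
    show "\<exists>t\<in>{refl 0}. f (s \<otimes>\<^bsub>G\<^esub> g) = t \<otimes>\<^bsub>G\<^esub> f g" if g: "g \<in> carrier G" and s: "s \<in> {rot l}" for g s
    proof -
      obtain x e where x: "g = (x, e)" "int x < 2 * l" "e < 2"
        using g carr l(1) by auto
      have sg: "s \<otimes>\<^bsub>G\<^esub> g = (nat ((l + int x) mod (2 * l)), e)"
        using s x l nat_add_mod[of l "int x"] by (auto simp: rot_def dihedral_def)
      show ?thesis
      proof (cases "int x < l")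
        case True
        then have "(l + int x) mod (2 * l) = l + int x" using l by simp
        then have "f (s \<otimes>\<^bsub>G\<^esub> g) = refl (- (int x + int e * l))"
          using l sg by (simp add: f_def)
        then show ?thesis using True by (simp add: f_def x)
      next
        case False
        then have "(l + int x) mod (2 * l) = (int x - l) mod (2 * l)"
          by (simp add: mod_eq_dvd_iff)
        also have "\<dots> = int x - l" using False x by simp
        finally have "f (s \<otimes>\<^bsub>G\<^esub> g) = rot (int x - l + int e * l)"
          using False x sg by (simp add: f_def)
        then show ?thesis using False by (simp add: f_def x algebra_simps)
      qed
    qed
  qed auto
  have "conn_set G {rot l}" "conn_set G {refl 0}"
    using l by (auto intro!: conn_setI simp: rot_eq_iff dest: zdvd_imp_le)
  moreover from this have "\<not> CI_subset G {rot l}"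
    using iso by (intro not_CI_if_refl[of 0 "{refl 0}"]) auto
  ultimately show ?thesis by (auto simp: has_DCI_def)
qed

text \<open>For \<open>D = -D\<close> the circulant digraph of \<open>D\<close> on \<open>\<int>/n\<close> is preserved by the regular dihedral group of the
  maps \<open>x \<mapsto> x + y\<close> (\<open>y\<close> even) and \<open>x \<mapsto> y - x\<close> (\<open>y\<close> odd), hence it is also a Cayley digraph of
  \<open>\<langle>a\<^sup>2, ab\<rangle>\<close>, with connection set \<open>mk ` D\<close>. The map \<open>\<theta>\<close> sends \<open>x\<close> to the inverse of the
  group element taking 0 to \<open>x\<close>.\<close>

lemma even_not_DCI:
  assumes "even n" and m: "2 \<le> m" "m \<le> n - 1"
  shows "\<not> has_DCI G m"
proof -
  define l where "l = int (n div 2)"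
  have l: "int n = 2 * l" "l \<ge> 2"
    using assms n_ge_3 unfolding l_def by (auto elim: evenE)
  define h where "h = int (m div 2)"
  have h: "int m = 2 * h + (if odd m then 1 else 0)"
    unfolding h_def by (auto simp: zdiv_int[symmetric] elim!: evenE oddE)
  have hl: "1 \<le> h" "h < l" using h l m by (auto split: if_splits)
  \<comment> \<open>A symmetric set of \<open>m\<close> nonzero residues: \<open>l\<close> is the
    only nonzero residue equal to its negative, so it settles the parity of \<open>m\<close>. As
    \<open>m\<close> is at least 2, \<open>D\<close> contains 1, which becomes a reflection under
    \<open>mk\<close>.\<close>
  define D where "D = {1..h} \<union> {-h..-1} \<union> (if odd m then {l} else {})"
  have card_D: "card D = m"
  proof -
    have "card D = card ({1..h} \<union> {-h..-1}) + (if odd m then 1 else 0)"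
      using hl unfolding D_def by (simp add: card_insert_if)
    also have "card ({1..h} \<union> {-h..-1}) = nat h + nat h"
      by (subst card_Un_disjoint) auto
    finally show ?thesis using h hl by (auto split: if_splits)
  qed
  have inj_D: "x = y" if "x \<in> D" "y \<in> D" "int n dvd x - y" for x y
  proof (rule ccontr)
    assume "x \<noteq> y"
    then have "int n \<le> \<bar>x - y\<bar>" using dvd_imp_le_int[OF _ that(3)] by simp
    then show False using that(1,2) hl l(1) by (auto simp: D_def split: if_splits)
  qed
  have D_nz: "\<not> int n dvd x" if "x \<in> D" for x
  proof
    assume "int n dvd x"
    moreover have "x \<noteq> 0" using that hl l by (auto simp: D_def split: if_splits)
    ultimately have "int n \<le> \<bar>x\<bar>" using dvd_imp_le_int[of x "int n"] by simp
    then show False using that hl l(1) by (auto simp: D_def split: if_splits)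
  qed
  have D_sym: "\<exists>d'\<in>D. int n dvd d' + d" if "d \<in> D" for d
  proof (cases "d = l")
    case True then show ?thesis using that l by (intro bexI[of _ l]) auto
  next
    case False
    then have "- d \<in> D" using that by (auto simp: D_def split: if_splits)
    then show ?thesis by (intro bexI[of _ "-d"]) auto
  qed
  have even_n: "even x \<longleftrightarrow> even y" if "int n dvd x - y" for x y
    proof -
    have "even (x - y)" using that l(1) by (metis dvd_trans dvd_triv_left)
    then show ?thesis by simp
  qed
  define mk where "mk x = (if even x then rot x else refl x)" for x
  define \<theta> where "\<theta> x = (if even x then rot (- x) else refl x)" for x
  \<comment> \<open>Rotations and reflections carry one copy each of the circulant digraph. The
    values of \<open>\<theta>\<close> form the subgroup of index 2, and right multiplication by
    \<open>rot 1\<close> moves the second copy to its other coset.\<close>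
  define f where "f g = (if snd g = 0 then \<theta> (int (fst g)) else \<theta> (int (fst g)) \<otimes>\<^bsub>G\<^esub> rot 1)"
    for g :: "nat \<times> nat"
  have \<theta>_cong: "\<theta> x = \<theta> y" if "int n dvd x - y" for x y
    using that even_n[OF that] by (auto simp: \<theta>_def rot_eq_iff refl_eq_iff dvd_diff_commute)
  have f: "f (rot x) = \<theta> x" "f (refl x) = \<theta> x \<otimes>\<^bsub>G\<^esub> rot 1" for x
    using n_pos \<theta>_cong[of "x mod int n" x] by (simp_all add: f_def rot_def[of x] refl_def[of x] mod_eq_dvd_iff[symmetric])
  have inj: "inj_on f (carrier G)"
  proof (rule inj_onI)
    fix g h assume "g \<in> carrier G" "h \<in> carrier G" "f g = f h"
    then show "g = h"
      by (elim dihedral_cases)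
        (auto simp: f \<theta>_def rot_eq_iff refl_eq_iff algebra_simps dvd_diff_commute dest: even_n split: if_splits)
  qed
  have \<theta>_step: "\<exists>d'\<in>D. \<theta> (d + x) = mk d' \<otimes>\<^bsub>G\<^esub> \<theta> x" if d: "d \<in> D" for d x
  proof -
    \<comment> \<open>If \<open>d + x\<close> is even, then \<open>\<theta> (d + x)\<close> has a
      negated exponent and the step is made by \<open>-d\<close> instead of \<open>d\<close>; this
      uses \<open>D = -D\<close>.\<close>
    obtain e where e: "e \<in> D" "int n dvd e + d" using D_sym[OF d] by blast
    have ev: "even e \<longleftrightarrow> even d" using even_n[of e "-d"] e by simp
    show ?thesis
    proof (cases "even x = even d")
      case True
      have "\<theta> (d + x) = mk e \<otimes>\<^bsub>G\<^esub> \<theta> x"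
        using True ev e by (auto simp: \<theta>_def mk_def rot_eq_iff algebra_simps dvd_diff_commute)
      then show ?thesis using e by blast
    next
      case False
      then have "\<theta> (d + x) = mk d \<otimes>\<^bsub>G\<^esub> \<theta> x"
        by (auto simp: \<theta>_def mk_def refl_eq_iff algebra_simps)
      then show ?thesis using d by blast
    qed
  qed
  have inj_mk: "inj_on mk D"
    by (rule inj_onI) (auto simp: mk_def rot_eq_iff refl_eq_iff dest: inj_D split: if_splits)
  have inj_rot: "inj_on rot D"
    by (rule inj_onI) (auto simp: rot_eq_iff dest: inj_D)
  have iso: "cay_iso G (rot ` D) (mk ` D)"
  proof (rule cay_isoI[OF finite_dihedral])
    show "bij_betw f (carrier G) (carrier G)"
      using inj by (intro bij_if_inj) (auto simp: f_def \<theta>_def)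
    show "card (rot ` D) = card (mk ` D)"
      by (simp add: card_image inj_mk inj_rot)
    show "\<exists>t\<in>mk ` D. f (s \<otimes>\<^bsub>G\<^esub> g) = t \<otimes>\<^bsub>G\<^esub> f g" if g: "g \<in> carrier G" and s: "s \<in> rot ` D" for g s
    proof -
      obtain d where d: "d \<in> D" "s = rot d" using s by blast
      have carr: "mk x \<in> carrier G" "\<theta> x \<in> carrier G" for x by (auto simp: mk_def \<theta>_def)
      show ?thesis using g
      proof (cases g rule: dihedral_cases)
        case (rot x) then show ?thesis using d \<theta>_step[OF d(1), of x] by (auto simp: f)
      next
        case (refl x)
        obtain d' where "d' \<in> D" "\<theta> (d + x) = mk d' \<otimes>\<^bsub>G\<^esub> \<theta> x" using \<theta>_step[OF d(1)] by blast
        then show ?thesis using d refl carr by (auto simp: f m_assoc)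
      qed
    qed
  qed (auto simp: mk_def)
  have "conn_set G (rot ` D)" "conn_set G (mk ` D)"
    using D_nz by (auto intro!: conn_setI simp: mk_def rot_eq_iff split: if_splits)
  moreover have "refl 1 \<in> mk ` D"
    using hl by (intro image_eqI[of _ _ 1]) (auto simp: mk_def D_def)
  ultimately have "\<not> CI_subset G (rot ` D)"
    using iso by (intro not_CI_if_refl[of 1 "mk ` D"]) auto
  then show ?thesis
    using \<open>conn_set G (rot ` D)\<close> card_D inj_rot by (auto simp: has_DCI_def card_image)
qed

end

section \<open>Non-CI subsets when a square divides n\<close>

context dih begin

text \<open>Let \<open>Q\<close> have order \<open>p\<close>, generated by \<open>rot \<epsilon>\<close>. Apart from \<open>rot \<epsilon>\<close> and the reflections in
  \<open>Qb\<close>, the set \<open>S\<close> is a union of \<open>Q\<close>-cosets, so inverting \<open>Q\<close> inside every coset of \<open>\<langle>Q, b\<rangle>\<close>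
  (the map \<open>f\<close>) is an isomorphism. A multiplier that fixes the coset \<open>1 + Q\<close> is 1 modulo \<open>p\<close>
  because \<open>p\<close> divides \<open>\<epsilon>\<close>, and hence cannot invert \<open>Q\<close>.\<close>

lemma square_dvd_not_DCI:
  assumes "odd n" "Factorial_Ring.prime p" "p ^ 2 dvd n" and m: "p + 1 \<le> m" "m \<le> n - 1"
  shows "\<not> has_DCI G m"
proof -
  obtain c where c: "n = p * (p * c)"
    using assms(3) by (auto simp: power2_eq_square dvd_def mult.assoc)
  define \<epsilon> where "\<epsilon> = int (p * c)"
  have n_eq: "int n = int p * \<epsilon>" by (simp add: c \<epsilon>_def)
  have p3: "p \<ge> 3"
  proof -
    have "odd p" using assms(1) c by auto
    moreover have "p \<ge> 2" using assms(2) by (simp add: prime_ge_2_nat)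
    ultimately show ?thesis by (cases "p = 2") auto
  qed
  have "c > 0" using n_ge_3 c by (cases c) auto
  then have p_\<epsilon>: "int p dvd \<epsilon>" "\<epsilon> \<ge> int p"
    unfolding \<epsilon>_def of_nat_le_iff by simp_all
  then have \<epsilon>3: "\<epsilon> \<ge> 3" using p3 by linarith
  have \<epsilon>_n: "\<epsilon> dvd int n" by (simp add: n_eq)
  \<comment> \<open>The decomposition \<open>m = 1 + p + p * t + r\<close> lists the blocks of
    \<open>S\<close> below: one element of \<open>Q\<close>, the coset \<open>aQ\<close>,
    \<open>t\<close> cosets of reflections other than \<open>Qb\<close>, and \<open>r < p\<close>
    elements of \<open>Qb\<close>.\<close>
  define t where "t = (m - 1 - p) div p"
  define r where "r = (m - 1 - p) mod p"
  have m_eq: "m = 1 + p + p * t + r" using m by (simp add: t_def r_def)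
  have r: "r < p" using p3 by (simp add: r_def)
  have t: "int t < \<epsilon>"
  proof -
    have "p * t < n" using m_eq m(2) n_ge_3 by linarith
    then have "int p * int t < int p * \<epsilon>" using n_eq by (metis of_nat_less_iff of_nat_mult)
    then show ?thesis using p3 by (simp add: mult_less_cancel_left)
  qed
  define S where "S \<sigma> = {rot (\<sigma> * \<epsilon>)} \<union> rot ` {x. \<epsilon> dvd x - 1} \<union> refl ` {x. x mod \<epsilon> \<in> {1..int t}}
      \<union> (\<lambda>j. refl (\<sigma> * (int j * \<epsilon>))) ` {..<r}" for \<sigma>
  have S_carr: "S \<sigma> \<subseteq> carrier G" for \<sigma> by (auto simp: S_def)
  have dvd_n: "int n dvd x * \<epsilon> \<longleftrightarrow> int p dvd x" for x using \<epsilon>3 by (simp add: n_eq)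
  have \<epsilon>_dvd: "\<epsilon> dvd x - y" if "int n dvd x - y" for x y using that \<epsilon>_n dvd_trans by blast
  have card_S: "card (S \<sigma>) = m" if \<sigma>: "\<sigma> = 1 \<or> \<sigma> = -1" for \<sigma>
  proof -
    have eq: "j = j'" if "int n dvd (a + int j * \<epsilon>) - (a' + int j' * \<epsilon>)" "j < p" "j' < p"
      "0 \<le> a" "a < \<epsilon>" "0 \<le> a'" "a' < \<epsilon>" "a = a'" for a a' j j'
    proof -
      have "int p dvd int j - int j'" using that dvd_n[of "int j - int j'"] by (simp add: algebra_simps)
      then show ?thesis using that(2,3)
        by (metis mod_eq_dvd_iff mod_less of_nat_eq_iff zmod_int)
    qed
    have A: "rot ` {x. \<epsilon> dvd x - 1} = (\<lambda>j. rot (1 + int j * \<epsilon>)) ` {..<p}" (is "?L = ?R")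
    proof
      show "?L \<subseteq> ?R"
      proof
        fix g assume "g \<in> ?L"
        then obtain k where g: "g = rot (1 + k * \<epsilon>)" by (auto simp: dvd_def algebra_simps)
        have "int n dvd (k - k mod int p) * \<epsilon>" using dvd_n mod_eq_dvd_iff by (metis mod_mod_trivial)
        then have "g = rot (1 + int (nat (k mod int p)) * \<epsilon>)" using p3 by (simp add: g rot_eq_iff algebra_simps)
        then show "g \<in> ?R" using p3 by (intro image_eqI[of _ _ "nat (k mod int p)"]) (auto simp: nat_less_iff)
      qed
    qed (auto simp: image_iff intro!: exI)
    have cA: "card (rot ` {x. \<epsilon> dvd x - 1}) = p" unfolding A
    proof (subst card_image)
      show "inj_on (\<lambda>j. rot (1 + int j * \<epsilon>)) {..<p}"
        using eq[of 1 _ 1] \<epsilon>3 by (auto intro!: inj_onI simp: rot_eq_iff)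
    qed simp
    have B: "refl ` {x. x mod \<epsilon> \<in> {1..int t}} = (\<lambda>(i, j). refl (i + int j * \<epsilon>)) ` ({1..int t} \<times> {..<p})" (is "?L = ?R")
    proof
      show "?L \<subseteq> ?R"
      proof
        fix g assume "g \<in> ?L"
        then obtain x where x: "g = refl x" "x mod \<epsilon> \<in> {1..int t}" by blast
        define k where "k = x div \<epsilon>"
        have "x = x mod \<epsilon> + k * \<epsilon>" by (simp add: k_def)
        then have "x - (x mod \<epsilon> + (k mod int p) * \<epsilon>) = (k - k mod int p) * \<epsilon>"
          unfolding left_diff_distrib by linarith
        moreover have "int n dvd (k - k mod int p) * \<epsilon>" using dvd_n mod_eq_dvd_iff by (metis mod_mod_trivial)
        ultimately have "int n dvd x - (x mod \<epsilon> + (k mod int p) * \<epsilon>)" by simp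
        then have "g = refl (x mod \<epsilon> + int (nat (k mod int p)) * \<epsilon>)" using p3 by (simp add: x refl_eq_iff)
        then show "g \<in> ?R" using p3 x by (intro image_eqI[of _ _ "(x mod \<epsilon>, nat (k mod int p))"]) (auto simp: nat_less_iff)
      qed
    qed (use t in \<open>auto intro!: imageI\<close>)
    have cB: "card (refl ` {x. x mod \<epsilon> \<in> {1..int t}}) = p * t" unfolding B
    proof (subst card_image)
      show "inj_on (\<lambda>(i, j). refl (i + int j * \<epsilon>)) ({1..int t} \<times> {..<p})"
      proof (rule inj_onI; clarsimp)
        fix i j i' j' assume *: "refl (i + int j * \<epsilon>) = refl (i' + int j' * \<epsilon>)" "1 \<le> i" "i \<le> int t" "1 \<le> i'" "i' \<le> int t" "j < p" "j' < p"
        then have d: "int n dvd (i + int j * \<epsilon>) - (i' + int j' * \<epsilon>)" by (simp add: refl_eq_iff)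
        then have "(i + int j * \<epsilon>) mod \<epsilon> = (i' + int j' * \<epsilon>) mod \<epsilon>"
          using \<epsilon>_dvd[OF d] by (simp only: mod_eq_dvd_iff)
        then have "i = i'" using * t by simp
        then show "i = i' \<and> j = j'" using eq[OF d] * t by simp
      qed
    qed (simp add: card_cartesian_product)
    have cC: "card ((\<lambda>j. refl (\<sigma> * (int j * \<epsilon>))) ` {..<r}) = r"
    proof (subst card_image)
      show "inj_on (\<lambda>j. refl (\<sigma> * (int j * \<epsilon>))) {..<r}"
      proof (rule inj_onI)
        fix j j' assume *: "j \<in> {..<r}" "j' \<in> {..<r}" "refl (\<sigma> * (int j * \<epsilon>)) = refl (\<sigma> * (int j' * \<epsilon>))"
        then have "int n dvd (0 + int j * \<epsilon>) - (0 + int j' * \<epsilon>)" using \<sigma> by (auto simp: refl_eq_iff dvd_diff_commute)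
        then show "j = j'" using eq[of 0 j 0 j'] * r \<epsilon>3 by auto
      qed
    qed simp
    have fin: "finite (rot ` {x. \<epsilon> dvd x - 1})" "finite (refl ` {x. x mod \<epsilon> \<in> {1..int t}})"
      unfolding A B by auto
    have d1: "rot (\<sigma> * \<epsilon>) \<notin> rot ` {x. \<epsilon> dvd x - 1}"
    proof -
      have False if "\<epsilon> dvd x - 1" "int n dvd \<sigma> * \<epsilon> - x" for x
      proof -
        have "\<epsilon> dvd (\<sigma> * \<epsilon> - x) + (x - 1)" using that \<epsilon>_dvd dvd_add by blast
        then have "\<epsilon> dvd \<sigma> * \<epsilon> - 1" by simp
        then have "\<epsilon> dvd 1" by (metis dvd_diff_commute dvd_diff_right_iff dvd_triv_right)
        then show False using \<epsilon>3 zdvd_imp_le[of \<epsilon> 1] by simp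
      qed
      then show ?thesis by (auto simp: rot_eq_iff)
    qed
    have d2: "refl ` {x. x mod \<epsilon> \<in> {1..int t}} \<inter> (\<lambda>j. refl (\<sigma> * (int j * \<epsilon>))) ` {..<r} = {}"
    proof -
      have False if "int n dvd \<sigma> * (int j * \<epsilon>) - x" "1 \<le> x mod \<epsilon>" for x j
      proof -
        have "\<epsilon> dvd \<sigma> * (int j * \<epsilon>) - x" using that \<epsilon>_dvd by blast
        then have "\<epsilon> dvd x" by (metis dvd_diff_right_iff dvd_mult dvd_triv_right)
        then show False using that by auto
      qed
      then show ?thesis by (auto simp: refl_eq_iff)
    qed
    have "card (S \<sigma>) = card (insert (rot (\<sigma> * \<epsilon>)) (rot ` {x. \<epsilon> dvd x - 1}))
        + card (refl ` {x. x mod \<epsilon> \<in> {1..int t}} \<union> (\<lambda>j. refl (\<sigma> * (int j * \<epsilon>))) ` {..<r})"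
      unfolding S_def using fin by (subst card_Un_disjoint[symmetric]) (auto simp: Un_assoc)
    also have "card (insert (rot (\<sigma> * \<epsilon>)) (rot ` {x. \<epsilon> dvd x - 1})) = Suc p"
      using fin d1 cA by simp
    also have "card (refl ` {x. x mod \<epsilon> \<in> {1..int t}} \<union> (\<lambda>j. refl (\<sigma> * (int j * \<epsilon>))) ` {..<r}) = p * t + r"
      using fin d2 cB cC by (subst card_Un_disjoint) auto
    finally show ?thesis using m_eq by simp
  qed
  have rot_S: "rot x \<in> S \<sigma> \<longleftrightarrow> int n dvd x - \<sigma> * \<epsilon> \<or> \<epsilon> dvd x - 1" for x \<sigma>
  proof -
    have "int n dvd x - y \<Longrightarrow> \<epsilon> dvd y - 1 \<Longrightarrow> \<epsilon> dvd x - 1" for y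
      using dvd_add[OF \<epsilon>_dvd, of x y "y - 1"] by simp
    then show ?thesis unfolding S_def by (auto simp: rot_eq_iff image_iff)
  qed
  have conn: "conn_set G (S \<sigma>)" if \<sigma>: "\<sigma> = 1 \<or> \<sigma> = -1" for \<sigma>
  proof (rule conn_setI[OF S_carr])
    have "\<not> \<epsilon> dvd 1" using \<epsilon>3 zdvd_imp_le[of \<epsilon> 1] by auto
    moreover have "\<not> int n dvd \<epsilon>" using dvd_n[of 1] p3 zdvd_imp_le[of "int p" 1] by auto
    ultimately show "rot 0 \<notin> S \<sigma>" using \<sigma> by (auto simp: rot_S)
  qed
  \<comment> \<open>Writing \<open>z = z0 + j * \<epsilon>\<close> with
    \<open>0 \<le> z0 < \<epsilon>\<close>, this gives \<open>z0 - j * \<epsilon>\<close>: the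
    representative stays and the \<open>Q\<close>-part is inverted.\<close>
  define \<tau> where "\<tau> z = 2 * (z mod \<epsilon>) - z" for z
  \<comment> \<open>The two signs on reflections make \<open>f\<close> commute with left
    multiplication by \<open>b = refl 0\<close>.\<close>
  define f where "f g = (if snd g = 0 then rot (\<tau> (int (fst g))) else refl (- \<tau> (- int (fst g))))"
    for g :: "nat \<times> nat"
  have \<tau>_cong: "int n dvd \<tau> x - \<tau> y" if "int n dvd x - y" for x y
    using that \<epsilon>_dvd[OF that] by (simp add: \<tau>_def mod_eq_dvd_iff[symmetric] dvd_diff_commute)
  have f_rot: "f (rot x) = rot (\<tau> x)" for x
    using n_pos \<tau>_cong[of "x mod int n" x]
    by (simp add: f_def rot_def[of x] rot_eq_iff mod_eq_dvd_iff[symmetric])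
  have f_refl: "f (refl x) = refl (- \<tau> (- x))" for x
    using n_pos \<tau>_cong[of "- x" "- (x mod int n)"]
    by (simp add: f_def refl_def[of x] refl_eq_iff mod_eq_dvd_iff[symmetric])
  have \<tau>_mod: "\<epsilon> dvd \<tau> z - z" for z
  proof -
    have "\<epsilon> dvd z mod \<epsilon> - z" by (simp add: mod_eq_dvd_iff[symmetric])
    moreover have "\<tau> z - z = (z mod \<epsilon> - z) * 2" by (simp add: \<tau>_def)
    ultimately show ?thesis using dvd_mult2 by metis
  qed
  have \<tau>_\<tau>: "\<tau> (\<tau> z) = z" for z
    using \<tau>_mod[of z] by (simp add: mod_eq_dvd_iff[symmetric]) (simp add: \<tau>_def)
  have ff: "f (f g) = g" if "g \<in> carrier G" for g
    using that by (cases g rule: dihedral_cases) (auto simp: f_rot f_refl \<tau>_\<tau>)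
  have bij: "bij_betw f (carrier G) (carrier G)"
    by (rule bij_if_inj) (auto simp: f_def intro: inj_on_inverseI[of _ f] ff)
  have \<tau>_shift: "\<tau> (x + j * \<epsilon>) = \<tau> x - j * \<epsilon>" "\<tau> (j * \<epsilon> + x) = \<tau> x - j * \<epsilon>"
    "\<tau> (x - j * \<epsilon>) = \<tau> x + j * \<epsilon>" "\<tau> (- (j * \<epsilon>) - x) = \<tau> (- x) + j * \<epsilon>"
    "\<tau> (j * \<epsilon> - x) = \<tau> (- x) - j * \<epsilon>" for x j
  proof -
    show *: "\<tau> (x + j * \<epsilon>) = \<tau> x - j * \<epsilon>" for x j by (simp add: \<tau>_def)
    show "\<tau> (j * \<epsilon> + x) = \<tau> x - j * \<epsilon>" using *[of x j] by (simp add: add.commute)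
    show "\<tau> (x - j * \<epsilon>) = \<tau> x + j * \<epsilon>" using *[of x "- j"] by simp
    show "\<tau> (- (j * \<epsilon>) - x) = \<tau> (- x) + j * \<epsilon>" using *[of "- x" "- j"] by (simp add: minus_diff_commute)
    show "\<tau> (j * \<epsilon> - x) = \<tau> (- x) - j * \<epsilon>" using *[of "- x" "j"] by (simp add: algebra_simps)
  qed
  have step: "\<exists>t\<in>S (-1). f (s \<otimes>\<^bsub>G\<^esub> g) = t \<otimes>\<^bsub>G\<^esub> f g" if g: "g \<in> carrier G" and s: "s \<in> S 1" for g s
  proof -
    consider "s = rot \<epsilon>" | x where "s = rot x" "\<epsilon> dvd x - 1" | y where "s = refl y" "y mod \<epsilon> \<in> {1..int t}"
      | j where "s = refl (int j * \<epsilon>)" "j < r"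
      using s by (auto simp: S_def)
    then show ?thesis
    proof cases
      case 1
      have "f (s \<otimes>\<^bsub>G\<^esub> g) = rot (- \<epsilon>) \<otimes>\<^bsub>G\<^esub> f g"
        using g \<tau>_shift[where j = 1]
        by (cases g rule: dihedral_cases) (auto simp: 1 f_rot f_refl rot_eq_iff refl_eq_iff)
      then show ?thesis by (intro bexI[of _ "rot (-\<epsilon>)"]) (auto simp: rot_S)
    next
      case 2
      show ?thesis using g
      proof (cases g rule: dihedral_cases)
        case (rot z)
        have "\<epsilon> dvd (\<tau> (x + z) - (x + z)) - (\<tau> z - z) + (x - 1)"
          by (rule dvd_add[OF dvd_diff[OF \<tau>_mod \<tau>_mod] 2(2)])
        then have "\<epsilon> dvd \<tau> (x + z) - \<tau> z - 1" by (simp add: algebra_simps)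
        then show ?thesis using rot 2 by (intro bexI[of _ "rot (\<tau> (x + z) - \<tau> z)"]) (auto simp: rot_S f_rot)
      next
        case (refl z)
        have "\<epsilon> dvd (\<tau> (- z) - (- z)) - (\<tau> (- (x + z)) - (- (x + z))) + (x - 1)"
          by (rule dvd_add[OF dvd_diff[OF \<tau>_mod \<tau>_mod] 2(2)])
        then have "\<epsilon> dvd - \<tau> (- (x + z)) + \<tau> (- z) - 1" by (simp add: algebra_simps)
        then show ?thesis using refl 2
          by (intro bexI[of _ "rot (- \<tau> (- (x + z)) + \<tau> (- z))"]) (auto simp: rot_S f_refl)
      qed
    next
      case 3
      have in_S: "refl y' \<in> S (-1)" if "\<epsilon> dvd y' - y" for y'
        using that 3 by (auto simp: S_def mod_eq_dvd_iff[symmetric])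
      show ?thesis using g
      proof (cases g rule: dihedral_cases)
        case (rot z)
        have "\<epsilon> dvd (\<tau> z - z) - (\<tau> (- (y - z)) - (- (y - z)))"
          by (rule dvd_diff[OF \<tau>_mod \<tau>_mod])
        then have "refl (- \<tau> (- (y - z)) + \<tau> z) \<in> S (-1)" by (intro in_S) (simp add: algebra_simps)
        then show ?thesis using rot 3 by (auto simp: f_rot f_refl intro!: bexI)
      next
        case (refl z)
        have "\<epsilon> dvd (\<tau> (y - z) - (y - z)) - (\<tau> (- z) - (- z))"
          by (rule dvd_diff[OF \<tau>_mod \<tau>_mod])
        then have "refl (\<tau> (y - z) - \<tau> (- z)) \<in> S (-1)" by (intro in_S) (simp add: algebra_simps)
        then show ?thesis using refl 3 by (auto simp: f_rot f_refl intro!: bexI)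
      qed
    next
      case 4
      have "f (s \<otimes>\<^bsub>G\<^esub> g) = refl (- (int j * \<epsilon>)) \<otimes>\<^bsub>G\<^esub> f g"
        using g
        by (cases g rule: dihedral_cases) (auto simp: 4 f_rot f_refl \<tau>_shift rot_eq_iff refl_eq_iff)
      then show ?thesis using 4 by (intro bexI[of _ "refl (- (int j * \<epsilon>))"]) (auto simp: S_def)
    qed
  qed
  have iso: "cay_iso G (S 1) (S (-1))"
    using step bij card_S by (intro cay_isoI[OF finite_dihedral]) (auto simp: S_carr)
  have "\<not> CI_subset G (S 1)"
  proof
    assume "CI_subset G (S 1)"
    then obtain \<alpha> where \<alpha>: "\<alpha> \<in> iso G G" "\<alpha> ` S 1 = S (-1)"
      using conn[of "-1"] iso unfolding CI_subset_def by blast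
    obtain v where v: "\<And>x. \<alpha> (rot x) = rot (v * x)" using iso_rot[OF \<alpha>(1)] by blast
    have img: "rot (v * x) \<in> S (-1)" if "rot x \<in> S 1" for x
      using imageI[OF that, of \<alpha>] by (simp add: \<alpha>(2) v)
    have "rot (v * \<epsilon>) \<in> S (-1)" "rot (v * 1) \<in> S (-1)"
      by (rule img, simp add: rot_S)+
    moreover have "\<not> \<epsilon> dvd v * \<epsilon> - 1"
    proof
      assume "\<epsilon> dvd v * \<epsilon> - 1"
      then have "\<epsilon> dvd v * \<epsilon> - (v * \<epsilon> - 1)" by (rule dvd_diff[OF dvd_triv_right])
      then have "\<epsilon> dvd 1" by (simp only: diff_diff_eq2 add_diff_cancel_left')
      then show False using \<epsilon>3 zdvd_imp_le[of \<epsilon> 1] by simp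
    qed
    \<comment> \<open>Since \<open>v * \<epsilon>\<close> is not 1 modulo \<open>\<epsilon>\<close>,
      \<open>rot \<epsilon>\<close> must go to \<open>rot (- \<epsilon>)\<close>, so
      \<open>v\<close> is -1 modulo \<open>p\<close>. But \<open>a\<close> goes either into
      \<open>aQ\<close> or to \<open>rot (- \<epsilon>)\<close>, which makes \<open>v\<close> equal
      to 1 or 0 modulo \<open>p\<close>; both are impossible for \<open>p \<ge> 3\<close>.\<close>
    ultimately have "int n dvd (v + 1) * \<epsilon>" and v1: "int n dvd v + \<epsilon> \<or> \<epsilon> dvd v - 1"
      by (auto simp: rot_S algebra_simps)
    then have pv: "int p dvd v + 1" using dvd_n by blast
    have "int p dvd v \<or> int p dvd v - 1"
      using v1
    proof
      assume "int n dvd v + \<epsilon>"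
      then have "int p dvd v + \<epsilon>" using n_eq dvd_mult_left by metis
      then show ?thesis using p_\<epsilon>(1) by (simp add: dvd_add_left_iff)
    next
      assume "\<epsilon> dvd v - 1" then show ?thesis using p_\<epsilon>(1) dvd_trans by blast
    qed
    then have "int p dvd 1 \<or> int p dvd 2"
    proof
      assume "int p dvd v" then show ?thesis using pv by (simp add: dvd_add_right_iff)
    next
      assume "int p dvd v - 1"
      then have "int p dvd (v + 1) - (v - 1)" using pv dvd_diff by blast
      then show ?thesis by simp
    qed
    then show False using p3 zdvd_imp_le[of "int p" 1] zdvd_imp_le[of "int p" 2] by auto
  qed
  then show ?thesis using conn[of 1] card_S[of 1] by (auto simp: has_DCI_def)
qed

end

section \<open>Fixed points of q-groups\<close>

text \<open>Elements of \<open>Bij E\<close> are extensional, hence the \<open>restrict\<close>.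
  Bijectivity is automatic because the action of the inverse undoes that of
  \<open>g\<close>.\<close>

lemma group_actionI:
  assumes "group G"
    and closed: "\<And>g x. g \<in> carrier G \<Longrightarrow> x \<in> E \<Longrightarrow> \<phi> g x \<in> E"
    and one: "\<And>x. x \<in> E \<Longrightarrow> \<phi> \<one>\<^bsub>G\<^esub> x = x"
    and mult: "\<And>g h x. g \<in> carrier G \<Longrightarrow> h \<in> carrier G \<Longrightarrow> x \<in> E \<Longrightarrow> \<phi> (g \<otimes>\<^bsub>G\<^esub> h) x = \<phi> g (\<phi> h x)"
  shows "group_action G E (\<lambda>g. restrict (\<phi> g) E)"
proof -
  interpret group G by fact
  have inv: "\<phi> (inv\<^bsub>G\<^esub> g) (\<phi> g x) = x" "\<phi> g (\<phi> (inv\<^bsub>G\<^esub> g) x) = x" if "g \<in> carrier G" "x \<in> E" for g x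
    using that one mult[of "inv\<^bsub>G\<^esub> g" g x] mult[of g "inv\<^bsub>G\<^esub> g" x] by auto
  have Bij: "restrict (\<phi> g) E \<in> Bij E" if g: "g \<in> carrier G" for g
  proof -
    have "bij_betw (\<phi> g) E E"
      by (rule bij_betw_byWitness[of _ "\<phi> (inv\<^bsub>G\<^esub> g)"]) (use g closed inv in auto)
    then show ?thesis by (simp add: Bij_def)
  qed
  have "group_hom G (BijGroup E) (\<lambda>g. restrict (\<phi> g) E)"
    using group_BijGroup Bij closed mult
    by (intro group_hom.intro group_hom_axioms.intro homI)
      (auto simp: BijGroup_def compose_def restrict_def fun_eq_iff group_axioms)
  then show ?thesis by (simp add: group_action_def)
qed

text \<open>Orbit lengths divide \<open>q ^ j\<close>, so every orbit that is not a fixed point has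
  length divisible by \<open>q\<close>.\<close>

lemma (in group_action) p_group_card_fixed:
  assumes fin: "finite E" and q: "Factorial_Ring.prime q" and ord: "order G = q ^ j"
  shows "[card {x \<in> E. \<forall>g\<in>carrier G. \<phi> g x = x} = card E] (mod q)"
proof -
  interpret G: group G using group_hom group_hom.axioms(1) by blast
  define fixed where "fixed x \<longleftrightarrow> (\<forall>g\<in>carrier G. \<phi> g x = x)" for x
  have orb: "[(\<Sum>x\<in>orb. if fixed x then 1 else 0) = (\<Sum>x\<in>orb. 1::nat)] (mod q)"
    if "orb \<in> orbits G E \<phi>" for orb
  proof -
    obtain x where x: "x \<in> E" "orb = orbit G \<phi> x" using \<open>orb \<in> _\<close> by (auto simp: orbits_def)
    show ?thesis
    proof (cases "fixed x")
      case True
      then have "orb = {x}" using x orbit_refl[OF x(1)] by (auto simp: orbit_def fixed_def)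
      then show ?thesis using True by simp
    next
      case False
      have "\<not> fixed y" if y_orb: "y \<in> orb" for y
      proof
        assume y: "fixed y"
        obtain g where g: "g \<in> carrier G" "\<phi> g x = y"
          using y_orb unfolding x(2) orbit_def by blast
        then have "\<phi> (inv\<^bsub>G\<^esub> g) y = x" using orbit_sym_aux x by blast
        then have "x = y" using y g(1) G.inv_closed unfolding fixed_def by metis
        then show False using y False by simp
      qed
      moreover have "q dvd card orb"
      proof (rule ccontr)
        assume "\<not> q dvd card orb"
        moreover have "card orb dvd q ^ j"
          using orbit_stabilizer_theorem[OF x(1)] x(2) ord by (metis dvd_triv_left)
        ultimately have "card orb = 1"
          using divides_primepow_nat[OF q, of "card orb" j] by (metis dvd_power not_gr_zero power_0)
        moreover have "x \<in> orb" using orbit_refl[OF x(1)] x(2) by simp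
        ultimately have "orb = {x}" by (auto simp: card_1_singleton_iff)
        then have "fixed x" using x(2) by (auto simp: fixed_def orbit_def)
        then show False using False by simp
      qed
      ultimately show ?thesis by (simp add: cong_def)
    qed
  qed
  have "card {x \<in> E. fixed x} = (\<Sum>x\<in>E. if fixed x then 1 else 0)"
    using fin by (simp add: sum.If_cases Int_def)
  also have "\<dots> = (\<Sum>orb\<in>orbits G E \<phi>. \<Sum>x\<in>orb. if fixed x then 1 else 0)"
    using disjoint_sum[OF fin] by metis
  also have "[\<dots> = (\<Sum>orb\<in>orbits G E \<phi>. \<Sum>x\<in>orb. 1)] (mod q)"
    by (rule cong_sum) (rule orb)
  also have "(\<Sum>orb\<in>orbits G E \<phi>. \<Sum>x\<in>orb. 1::nat) = card E"
    using disjoint_sum[OF fin, of "\<lambda>_. 1::nat"] by simp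
  finally show ?thesis by (simp add: fixed_def)
qed

text \<open>Counts the fixed points of the \<open>q\<close>-group \<open>R\<close> on the left cosets of \<open>K\<close>.\<close>

lemma (in group) card_transporter:
  assumes fin: "finite (carrier G)" and R: "subgroup R G" and K: "subgroup K G"
    and q: "Factorial_Ring.prime q" and cR: "card R = q ^ j"
  defines "M \<equiv> {g \<in> carrier G. \<forall>r\<in>R. \<exists>k\<in>K. r \<otimes> g = g \<otimes> k}"
  obtains c c' where "card M = c * card K" "order G = c' * card K" "[c = c'] (mod q)"
proof -
  interpret R: subgroup R G by fact
  interpret K: subgroup K G by fact
  define E where "E = lcosets\<^bsub>G\<^esub> K"
  have E: "B \<in> E \<longleftrightarrow> (\<exists>g\<in>carrier G. B = g <# K)" for B by (auto simp: E_def LCOSETS_def)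
  have Esub: "B \<subseteq> carrier G" if "B \<in> E" for B
    using that K.lcosets_carrier[OF group_axioms] by (auto simp: E_def)
  have finE: "finite E" using fin by (simp add: E_def LCOSETS_def)
  interpret act: group_action "G\<lparr>carrier := R\<rparr>" E "\<lambda>r. restrict (\<lambda>B. r <# B) E"
  proof (rule group_actionI)
    show "group (G\<lparr>carrier := R\<rparr>)" using R subgroup_imp_group by blast
    show "r <# B \<in> E" if r_R: "r \<in> carrier (G\<lparr>carrier := R\<rparr>)" and B_E: "B \<in> E" for r B
    proof -
      obtain g where g: "g \<in> carrier G" "B = g <# K" using B_E unfolding E by blast
      have r: "r \<in> carrier G" using r_R by simp
      then have "r <# B = (r \<otimes> g) <# K" using g lcos_m_assoc[OF K.subset] by simp
      then show ?thesis using r g(1) unfolding E by blast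
    qed
  qed (auto simp: lcos_m_assoc Esub lcos_mult_one)
  define F where "F = {B \<in> E. \<forall>r\<in>R. r <# B = B}"
  have "[card F = card E] (mod q)"
    using act.p_group_card_fixed[OF finE q, of j] cR by (simp add: F_def order_def cong: conj_cong)
  moreover have "card M = card F * card K"
  proof -
    \<comment> \<open>The coset \<open>gK\<close> is fixed by \<open>R\<close> exactly when the
      conjugate of \<open>R\<close> by \<open>g\<close> lies in \<open>K\<close>; hence
      \<open>M\<close> is the disjoint union of the fixed cosets.\<close>
    have in_F: "g <# K \<in> F \<longleftrightarrow> g \<in> M" if g: "g \<in> carrier G" for g
    proof -
      have "r <# (g <# K) = g <# K \<longleftrightarrow> (\<exists>k\<in>K. r \<otimes> g = g \<otimes> k)" if r: "r \<in> R" for r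
      proof -
        have "r <# (g <# K) = (r \<otimes> g) <# K" using r g lcos_m_assoc K.subset by auto
        moreover have "(r \<otimes> g) <# K = g <# K \<longleftrightarrow> r \<otimes> g \<in> g <# K"
          using r g K lcos_self l_repr_independence by (metis R.mem_carrier m_closed)
        ultimately show ?thesis by (auto simp: l_coset_def)
      qed
      then show ?thesis using g by (auto simp: F_def E M_def)
    qed
    have "M = \<Union>F"
    proof (intro equalityI subsetI)
      fix g assume "g \<in> M"
      then show "g \<in> \<Union>F" using in_F lcos_self[OF _ K] by (force simp: M_def)
    next
      fix g assume "g \<in> \<Union>F"
      then obtain B h where B: "g \<in> B" "B \<in> F" "h \<in> carrier G" "B = h <# K"
        by (auto simp: F_def E)
      then have "g <# K = B" using l_repr_independence K by metis
      moreover have "g \<in> carrier G" using B Esub by (auto simp: F_def)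
      ultimately show "g \<in> M" using in_F B by blast
    qed
    moreover have "card K * card F = card (\<Union>F)"
    proof (rule card_partition)
      have FE: "F \<subseteq> E" by (auto simp: F_def)
      then show "finite F" using finE finite_subset by blast
      show "finite (\<Union>F)" using \<open>M = \<Union>F\<close> fin finite_subset[of M "carrier G"] by (auto simp: M_def)
      show "card c = card K" if "c \<in> F" for c
        using that l_card_cosets_equal[OF _ K.subset fin, of c] by (simp add: F_def E_def)
      show "c1 \<inter> c2 = {}" if "c1 \<in> F" "c2 \<in> F" "c1 \<noteq> c2" for c1 c2
        using that lcos_disjoint[OF K, of c1 c2] by (auto simp: F_def E_def)
    qed
    ultimately show ?thesis by (simp add: mult.commute)
  qed
  moreover have "order G = card E * card K"
    using l_lagrange[OF fin K] by (simp add: E_def)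
  ultimately show thesis using that by blast
qed

text \<open>The index of \<open>K\<close> is prime to \<open>q\<close>, so the number of cosets
  fixed by \<open>R\<close> is nonzero modulo \<open>q\<close>. Any fixed coset supplies the
  conjugating element.\<close>

lemma (in group) p_subgroup_conjugate:
  assumes fin: "finite (carrier G)" and R: "subgroup R G" and K: "subgroup K G"
    and q: "Factorial_Ring.prime q" and cR: "card R = q ^ j" and nd: "\<not> q * card K dvd order G"
  obtains g where "g \<in> carrier G" "\<And>r. r \<in> R \<Longrightarrow> \<exists>k\<in>K. r \<otimes> g = g \<otimes> k"
proof -
  define M where "M = {g \<in> carrier G. \<forall>r\<in>R. \<exists>k\<in>K. r \<otimes> g = g \<otimes> k}"
  obtain c c' where c: "card M = c * card K" "order G = c' * card K" "[c = c'] (mod q)"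
    using card_transporter[OF fin R K q cR] unfolding M_def by blast
  have "\<not> q dvd c'" using nd c(2) by auto
  then have "c \<noteq> 0" using cong_dvd_iff[OF c(3)] by (metis dvd_0_right)
  moreover have "card K \<noteq> 0"
    using subgroup.finite_imp_card_positive[OF K fin] by simp
  ultimately have "M \<noteq> {}" using c(1) by auto
  then show thesis using that by (auto simp: M_def)
qed

text \<open>The case \<open>K = R\<close> of the count: the set is the normalizer of
  \<open>R\<close>, and \<open>q\<close> divides the number of fixed cosets along with the index of
  \<open>R\<close>.\<close>

lemma (in group) card_normalizer_dvd:
  assumes fin: "finite (carrier G)" and R: "subgroup R G"
    and q: "Factorial_Ring.prime q" and cR: "card R = q ^ j" and dvd: "q * card R dvd order G"
  shows "q * card R dvd card {g \<in> carrier G. \<forall>r\<in>R. \<exists>k\<in>R. r \<otimes> g = g \<otimes> k}"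
proof -
  obtain c c' where c: "card {g \<in> carrier G. \<forall>r\<in>R. \<exists>k\<in>R. r \<otimes> g = g \<otimes> k} = c * card R"
    "order G = c' * card R" "[c = c'] (mod q)"
    using card_transporter[OF fin R R q cR] by blast
  have "card R \<noteq> 0" using subgroup.finite_imp_card_positive[OF R fin] by simp
  then have "q dvd c'" using dvd c(2) by (simp add: mult.commute)
  then have "q dvd c" using c(3) cong_dvd_iff by blast
  then show ?thesis using c(1) by (simp add: mult.commute)
qed

lemma (in group) cauchy_element:
  assumes fin: "finite (carrier G)" and q: "Factorial_Ring.prime q" and dvd: "q dvd order G"
  obtains z where "z \<in> carrier G" "z \<noteq> \<one>" "z [^] q = \<one>"
proof -
  obtain m where "order G = q ^ 1 * m" using dvd by auto
  then obtain H where H: "subgroup H G" "card H = q ^ 1"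
    using sylow_thm[OF q group_axioms _ fin] by blast
  interpret H: subgroup H G by fact
  have "H \<noteq> {\<one>}" using H(2) q by (auto simp: not_prime_1)
  then obtain z where z: "z \<in> H" "z \<noteq> \<one>" using H.one_closed by blast
  have "z [^]\<^bsub>G\<lparr>carrier := H\<rparr>\<^esub> order (G\<lparr>carrier := H\<rparr>) = \<one>\<^bsub>G\<lparr>carrier := H\<rparr>\<^esub>"
    using z H(1) subgroup_imp_group by (intro group.pow_order_eq_1) auto
  then have "z [^] q = \<one>"
    using H(2) by (simp add: order_def nat_pow_def)
  then show thesis using that z H.mem_carrier by blast
qed

section \<open>Isomorphisms and automorphisms of Cayley digraphs\<close>

lemma (in group) finite_closed_imp_subgroup:
  assumes fin: "finite (carrier G)" and H: "H \<subseteq> carrier G" "\<one> \<in> H"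
    and closed: "\<And>x y. x \<in> H \<Longrightarrow> y \<in> H \<Longrightarrow> x \<otimes> y \<in> H"
  shows "subgroup H G"
proof (rule subgroupI)
  show "inv x \<in> H" if x: "x \<in> H" for x
  proof -
    have xG: "x \<in> carrier G" using x H by blast
    have pow: "x [^] (k::nat) \<in> H" for k by (induction k) (use x H closed in auto)
    have "order G > 0" using fin order_gt_0_iff_finite by simp
    then have "x [^] (order G - 1) \<otimes> x = x [^] order G"
      by (metis Suc_diff_1 nat_pow_Suc)
    then have "inv x = x [^] (order G - 1)"
      using pow_order_eq_1[OF xG] xG by (intro inv_equality) auto
    then show ?thesis using pow by simp
  qed
qed (use H closed in auto)

text \<open>Defined by directed walks from the identity, so that an isomorphism fixing the identity
  can be followed arc by arc. In a finite group this is the subgroup generated by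
  \<open>S\<close>.\<close>

inductive_set reach :: "('a, 'b) monoid_scheme \<Rightarrow> 'a set \<Rightarrow> 'a set"
  for G :: "('a, 'b) monoid_scheme" and S :: "'a set" where
  one: "\<one>\<^bsub>G\<^esub> \<in> reach G S"
| step: "x \<in> reach G S \<Longrightarrow> s \<in> S \<Longrightarrow> s \<otimes>\<^bsub>G\<^esub> x \<in> reach G S"

context group begin

lemma reach_subgroup:
  assumes fin: "finite (carrier G)" and S: "S \<subseteq> carrier G"
  shows "subgroup (reach G S) G"
proof (rule finite_closed_imp_subgroup[OF fin])
  show sub: "reach G S \<subseteq> carrier G"
  proof
    show "x \<in> carrier G" if "x \<in> reach G S" for x
      using that by induction (use S in auto)
  qed
  show "x \<otimes> y \<in> reach G S" if "x \<in> reach G S" and y: "y \<in> reach G S" for x y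
    using that(1)
  proof induction
    case one then show ?case using y sub by auto
  next
    case (step x s)
    then have "s \<otimes> x \<otimes> y = s \<otimes> (x \<otimes> y)" using S sub y by (intro m_assoc) auto
    then show ?case using step reach.step by metis
  qed
qed (rule reach.one)

lemma reach_generators:
  assumes "S \<subseteq> carrier G" shows "S \<subseteq> reach G S"
proof
  fix s assume "s \<in> S"
  then show "s \<in> reach G S" using reach.step[OF reach.one, of s S G] assms by auto
qed

lemma reach_least:
  assumes "subgroup K G" "S \<subseteq> K" shows "reach G S \<subseteq> K"
proof
  show "x \<in> K" if "x \<in> reach G S" for x
    using that
  proof induction
    case one show ?case by (rule subgroup.one_closed[OF assms(1)])
  next
    case (step x s)
    then show ?case using subgroup.m_closed[OF assms(1)] assms(2) by blast
  qed
qed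

lemma cay_arcs_iff:
  "g \<in> carrier G \<Longrightarrow> (g, y) \<in> cay_arcs G S \<longleftrightarrow> (\<exists>s\<in>S. y = s \<otimes> g)"
  by (auto simp: cay_arcs_def)

lemma cay_arcs_mult_right:
  assumes "g \<in> carrier G" "h \<in> carrier G" "c \<in> carrier G" "S \<subseteq> carrier G"
  shows "(g \<otimes> c, h \<otimes> c) \<in> cay_arcs G S \<longleftrightarrow> (g, h) \<in> cay_arcs G S"
proof -
  have "h \<otimes> c = s \<otimes> (g \<otimes> c) \<longleftrightarrow> h = s \<otimes> g" if "s \<in> S" for s
  proof -
    have s: "s \<in> carrier G" using that assms(4) by blast
    then have "s \<otimes> (g \<otimes> c) = s \<otimes> g \<otimes> c" using assms by (simp add: m_assoc)
    then show ?thesis using assms s by simp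
  qed
  then show ?thesis using assms by (auto simp: cay_arcs_iff)
qed

lemma cay_arcs_one: "S \<subseteq> carrier G \<Longrightarrow> (\<one>, y) \<in> cay_arcs G S \<longleftrightarrow> y \<in> S"
  by (auto simp: cay_arcs_iff subset_iff) 

end

section \<open>Isomorphisms between components of Cayley digraphs\<close>

definition cay_iso_on :: "('a, 'b) monoid_scheme \<Rightarrow> 'a set \<Rightarrow> 'a set \<Rightarrow> 'a set \<Rightarrow> 'a set \<Rightarrow> ('a \<Rightarrow> 'a) \<Rightarrow> bool" where
  "cay_iso_on G H S H' T f \<longleftrightarrow> bij_betw f H H' \<and>
    (\<forall>x\<in>H. \<forall>y\<in>H. (x, y) \<in> cay_arcs G S \<longleftrightarrow> (f x, f y) \<in> cay_arcs G T)"

lemma cay_iso_onD: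
  assumes "cay_iso_on G H S H' T f"
  shows "bij_betw f H H'"
    and "x \<in> H \<Longrightarrow> y \<in> H \<Longrightarrow> (f x, f y) \<in> cay_arcs G T \<longleftrightarrow> (x, y) \<in> cay_arcs G S"
    and "x \<in> H \<Longrightarrow> f x \<in> H'"
  using assms unfolding cay_iso_on_def bij_betw_def by blast+

lemma cay_iso_on_comp:
  assumes "cay_iso_on G H S H' T f" "cay_iso_on G H' T H'' U g"
  shows "cay_iso_on G H S H'' U (g \<circ> f)"
  using assms bij_betw_trans[of f H H' g H''] by (auto simp: cay_iso_on_def dest: bij_betwE)

lemma cay_iso_on_inv:
  assumes "cay_iso_on G H S H' T f"
  shows "cay_iso_on G H' T H S (inv_into H f)"
proof -
  have f: "bij_betw f H H'" using assms by (simp add: cay_iso_on_def)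
  have inv: "inv_into H f y \<in> H" "f (inv_into H f y) = y" if "y \<in> H'" for y
    using that f by (auto simp: bij_betw_def inv_into_into f_inv_into_f)
  show ?thesis unfolding cay_iso_on_def
  proof (intro conjI ballI)
    show "bij_betw (inv_into H f) H' H" using f by (rule bij_betw_inv_into)
    show "(x, y) \<in> cay_arcs G T \<longleftrightarrow> (inv_into H f x, inv_into H f y) \<in> cay_arcs G S"
      if "x \<in> H'" "y \<in> H'" for x y
      using cay_iso_onD(2)[OF assms, of "inv_into H f x" "inv_into H f y"] inv that by simp
  qed
qed

lemma (in group) cay_iso_on_mult_right:
  assumes "subgroup H G" "S \<subseteq> carrier G" "c \<in> H"
  shows "cay_iso_on G H S H S (\<lambda>x. x \<otimes> c)"
proof -
  interpret H: subgroup H G by fact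
  have c: "c \<in> carrier G" using assms by auto
  have "bij_betw (\<lambda>x. x \<otimes> c) H H"
    by (rule bij_betw_byWitness[of _ "\<lambda>x. x \<otimes> inv c"]) (use assms c in \<open>auto simp: m_assoc\<close>)
  then show ?thesis using cay_arcs_mult_right[OF _ _ c assms(2)] by (auto simp: cay_iso_on_def)
qed

lemma (in group) cay_iso_on_generators:
  assumes f: "cay_iso_on G H S H' T f" and "f \<one> = \<one>" "\<one> \<in> H"
    and S: "S \<subseteq> carrier G" "S \<subseteq> H" and T: "T \<subseteq> carrier G" "T \<subseteq> H'"
  shows "f ` S = T"
proof -
  have iff: "f x \<in> T \<longleftrightarrow> x \<in> S" if "x \<in> H" for x
    using cay_iso_onD(2)[OF f \<open>\<one> \<in> H\<close> that] assms(2) cay_arcs_one S T by simp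
  show ?thesis
  proof (intro equalityI subsetI)
    fix y assume y: "y \<in> T"
    then obtain x where "x \<in> H" "y = f x"
      using cay_iso_onD(1)[OF f] T by (auto simp: bij_betw_def)
    then show "y \<in> f ` S" using iff y by blast
  qed (use iff S in auto)
qed

text \<open>A right translation brings the image of the identity back to the identity. The
  isomorphism and its inverse then both carry walks from the identity to walks from the
  identity.\<close>

lemma (in group) cay_iso_reach:
  assumes "cay_iso G S T" and S: "S \<subseteq> carrier G" and T: "T \<subseteq> carrier G"
  obtains f where "cay_iso_on G (reach G S) S (reach G T) T f" "f \<one> = \<one>"
proof -
  obtain f0 where f0: "cay_iso_on G (carrier G) S (carrier G) T f0"
    using assms(1) by (auto simp: cay_iso_def cay_iso_on_def)
  define c where "c = inv (f0 \<one>)"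
  have f01: "f0 \<one> \<in> carrier G" using cay_iso_onD(3)[OF f0] by simp
  define f where "f = (\<lambda>x. x \<otimes> c) \<circ> f0"
  have f: "cay_iso_on G (carrier G) S (carrier G) T f" unfolding f_def
    by (rule cay_iso_on_comp[OF f0 cay_iso_on_mult_right[OF subgroup_self T]])
      (simp add: c_def f01)
  have f1: "f \<one> = \<one>" using f01 by (simp add: f_def c_def)
  have into: "g ` reach G U \<subseteq> reach G V"
    if g: "cay_iso_on G (carrier G) U (carrier G) V g" "g \<one> = \<one>" and U: "U \<subseteq> carrier G" for g U V
  proof (intro image_subsetI)
    fix x assume "x \<in> reach G U"
    then have "x \<in> carrier G \<and> g x \<in> reach G V"
    proof induction
      case one then show ?case using g by (simp add: reach.one)
    next
      case (step x s)
      then have "(g x, g (s \<otimes> x)) \<in> cay_arcs G V"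
        using cay_iso_onD(2)[OF g(1), of x "s \<otimes> x"] U by (auto simp: cay_arcs_iff)
      then obtain t where "t \<in> V" "g (s \<otimes> x) = t \<otimes> g x" by (auto simp: cay_arcs_def)
      then show ?case using step U reach.step by auto
    qed
    then show "g x \<in> reach G V" by simp
  qed
  have sub: "reach G S \<subseteq> carrier G" "reach G T \<subseteq> carrier G"
    using S T reach_least[OF subgroup_self] by auto
  let ?h = "inv_into (carrier G) f"
  have bij: "bij_betw f (carrier G) (carrier G)" using cay_iso_onD(1)[OF f] .
  have "?h \<one> = \<one>" using bij f1 by (metis bij_betw_inv_into_left one_closed)
  then have "?h ` reach G T \<subseteq> reach G S"
    using into[OF cay_iso_on_inv[OF f] _ T] by simp
  moreover have "f (?h y) = y" if "y \<in> reach G T" for y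
    using that bij sub by (meson bij_betw_inv_into_right subsetD)
  ultimately have "reach G T \<subseteq> f ` reach G S" by (metis image_eqI image_subset_iff subsetI)
  then have "f ` reach G S = reach G T" using into[OF f f1 S] by blast
  then have "cay_iso_on G (reach G S) S (reach G T) T f"
    using f sub inj_on_subset by (fastforce simp: cay_iso_on_def bij_betw_def)
  then show thesis using that f1 by blast
qed

section \<open>Automorphism groups of components\<close>

definition aut_group :: "'a set \<Rightarrow> ('a \<times> 'a) set \<Rightarrow> ('a \<Rightarrow> 'a) monoid" where
  "aut_group V A = \<lparr>carrier = {\<pi>. \<pi> permutes V \<and> (\<forall>x\<in>V. \<forall>y\<in>V. (x, y) \<in> A \<longleftrightarrow> (\<pi> x, \<pi> y) \<in> A)},
     monoid.mult = (\<circ>), one = id\<rparr>"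

lemma aut_group_simps [simp]:
  "x \<otimes>\<^bsub>aut_group V A\<^esub> y = x \<circ> y" "\<one>\<^bsub>aut_group V A\<^esub> = id"
  by (simp_all add: aut_group_def)

lemma aut_group_iff:
  "\<pi> \<in> carrier (aut_group V A) \<longleftrightarrow> \<pi> permutes V \<and> (\<forall>x\<in>V. \<forall>y\<in>V. (x, y) \<in> A \<longleftrightarrow> (\<pi> x, \<pi> y) \<in> A)"
  by (simp add: aut_group_def)

lemma aut_groupD:
  assumes "\<pi> \<in> carrier (aut_group V A)"
  shows "\<pi> permutes V" "x \<in> V \<Longrightarrow> y \<in> V \<Longrightarrow> (\<pi> x, \<pi> y) \<in> A \<longleftrightarrow> (x, y) \<in> A" "x \<in> V \<Longrightarrow> \<pi> x \<in> V"
  using assms unfolding aut_group_iff by (blast, blast, simp add: permutes_in_image)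

lemma group_aut_group: "group (aut_group V A)"
proof (rule groupI)
  fix \<pi> assume \<pi>: "\<pi> \<in> carrier (aut_group V A)"
  note p = aut_groupD[OF this]
  have "inv_into UNIV \<pi> \<in> carrier (aut_group V A)"
  proof -
    have "(inv_into UNIV \<pi> x, inv_into UNIV \<pi> y) \<in> A \<longleftrightarrow> (x, y) \<in> A" if "x \<in> V" "y \<in> V" for x y
      using p(2)[of "inv_into UNIV \<pi> x" "inv_into UNIV \<pi> y"] that permutes_inv[OF p(1)]
      by (simp add: permutes_in_image permutes_inverses[OF p(1)])
    then show ?thesis using permutes_inv[OF p(1)] unfolding aut_group_iff by blast
  qed
  then show "\<exists>\<sigma>\<in>carrier (aut_group V A). \<sigma> \<otimes>\<^bsub>aut_group V A\<^esub> \<pi> = \<one>\<^bsub>aut_group V A\<^esub>"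
    using permutes_inv_o[OF p(1)] by auto
next
  fix \<pi> \<sigma> assume "\<pi> \<in> carrier (aut_group V A)" "\<sigma> \<in> carrier (aut_group V A)"
  note p = aut_groupD[OF this(1)] and s = aut_groupD[OF this(2)]
  show "\<pi> \<otimes>\<^bsub>aut_group V A\<^esub> \<sigma> \<in> carrier (aut_group V A)"
    unfolding aut_group_iff aut_group_simps
    using permutes_compose[OF s(1) p(1)] by (simp add: p(2) s(2,3))
qed (simp_all add: aut_group_iff permutes_id o_assoc)

lemma finite_aut_group: "finite V \<Longrightarrow> finite (carrier (aut_group V A))"
  using finite_permutations[of V] by (auto simp: aut_group_def elim: finite_subset[rotated])

lemma aut_group_pow: "\<pi> [^]\<^bsub>aut_group V A\<^esub> (k::nat) = \<pi> ^^ k"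
  by (induction k) (simp_all add: nat_pow_def funpow_Suc_right del: funpow.simps(2))

lemma cay_iso_on_aut:
  "\<pi> \<in> carrier (aut_group H (cay_arcs G S)) \<Longrightarrow> cay_iso_on G H S H S \<pi>"
  unfolding aut_group_iff cay_iso_on_def using permutes_imp_bij by blast

text \<open>Extending by the identity outside \<open>H\<close> meets the convention of
  \<open>permutes\<close>, under which plain composition and \<open>id\<close> give the group
  structure.\<close>

lemma aut_cay_iso_on:
  assumes "cay_iso_on G H S H S f"
  shows "(\<lambda>x. if x \<in> H then f x else x) \<in> carrier (aut_group H (cay_arcs G S))"
proof -
  have "bij_betw (\<lambda>x. if x \<in> H then f x else x) H H"
    using cay_iso_onD(1)[OF assms] bij_betw_cong[of H "\<lambda>x. if x \<in> H then f x else x" f H] by simp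
  then have "(\<lambda>x. if x \<in> H then f x else x) permutes H"
    by (rule bij_imp_permutes) simp
  then show ?thesis using cay_iso_onD(2)[OF assms] by (simp add: aut_group_iff)
qed

text \<open>Conjugation by \<open>f\<close> embeds one automorphism group into the other; the
  inverse of \<open>f\<close> later gives the reverse inequality.\<close>

lemma order_aut_group_le:
  assumes f: "cay_iso_on G H S H' T f" and fin: "finite H'"
  shows "order (aut_group H (cay_arcs G S)) \<le> order (aut_group H' (cay_arcs G T))"
proof -
  define \<Phi> where "\<Phi> \<pi> = (\<lambda>y. if y \<in> H' then (f \<circ> (\<pi> \<circ> inv_into H f)) y else y)" for \<pi>
  have "\<Phi> ` carrier (aut_group H (cay_arcs G S)) \<subseteq> carrier (aut_group H' (cay_arcs G T))"
  proof (intro image_subsetI)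
    fix \<pi> assume "\<pi> \<in> carrier (aut_group H (cay_arcs G S))"
    then have "cay_iso_on G H' T H' T (f \<circ> (\<pi> \<circ> inv_into H f))"
      by (intro cay_iso_on_comp[OF cay_iso_on_comp[OF cay_iso_on_inv[OF f] cay_iso_on_aut] f])
    then show "\<Phi> \<pi> \<in> carrier (aut_group H' (cay_arcs G T))"
      unfolding \<Phi>_def by (rule aut_cay_iso_on)
  qed
  moreover have "inj_on \<Phi> (carrier (aut_group H (cay_arcs G S)))"
  proof (rule inj_onI)
    fix \<pi> \<sigma> assume p: "\<pi> \<in> carrier (aut_group H (cay_arcs G S))" and s: "\<sigma> \<in> carrier (aut_group H (cay_arcs G S))"
      and eq: "\<Phi> \<pi> = \<Phi> \<sigma>"
    have inj: "inj_on f H" using cay_iso_onD(1)[OF f] by (simp add: bij_betw_def)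
    have "\<pi> x = \<sigma> x" for x
    proof (cases "x \<in> H")
      case True
      then have "f (\<pi> x) = f (\<sigma> x)"
        using fun_cong[OF eq, of "f x"] cay_iso_onD(3)[OF f True] inv_into_f_f[OF inj True] by (simp add: \<Phi>_def)
      then show ?thesis using inj True aut_groupD(3)[OF p] aut_groupD(3)[OF s]
        by (auto dest: inj_onD)
    next
      case False
      then show ?thesis using aut_groupD(1)[OF p] aut_groupD(1)[OF s] by (simp add: permutes_not_in)
    qed
    then show "\<pi> = \<sigma>" by auto
  qed
  ultimately show ?thesis
    unfolding order_def using finite_aut_group[OF fin] card_inj_on_le by blast
qed

lemma order_aut_group_eq:
  assumes f: "cay_iso_on G H S H' T f" and "finite H" "finite H'"
  shows "order (aut_group H (cay_arcs G S)) = order (aut_group H' (cay_arcs G T))"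
  using order_aut_group_le[OF f] order_aut_group_le[OF cay_iso_on_inv[OF f]] assms(2,3)
  by (simp add: le_antisym)

text \<open>The right translations by \<open>C\<close>, pulled back along \<open>f\<close>.\<close>

definition pulled :: "('a, 'b) monoid_scheme \<Rightarrow> 'a set \<Rightarrow> ('a \<Rightarrow> 'a) \<Rightarrow> 'a \<Rightarrow> 'a \<Rightarrow> 'a" where
  "pulled G H f c x = (if x \<in> H then inv_into H f (f x \<otimes>\<^bsub>G\<^esub> c) else x)"

context group begin

text \<open>For \<open>f\<close> the identity this is the group of right translations by
  \<open>C\<close>; a general \<open>f\<close> brings the translations of the other component into
  the same automorphism group, where the two copies can be compared.\<close>

lemma pulled_subgroup:
  assumes f: "cay_iso_on G H S H' T f" and H: "finite H" "H \<noteq> {}" and H': "subgroup H' G"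
    and T: "T \<subseteq> carrier G" and C: "subgroup C G" "C \<subseteq> H'"
  shows "subgroup (pulled G H f ` C) (aut_group H (cay_arcs G S))" (is ?subg)
    and "card (pulled G H f ` C) = card C" (is ?card)
proof -
  interpret H': subgroup H' G by fact
  interpret C: subgroup C G by fact
  interpret A: group "aut_group H (cay_arcs G S)" by (rule group_aut_group)
  have bij: "bij_betw f H H'" by (rule cay_iso_onD(1)[OF f])
  have finv: "f (inv_into H f y) = y" "inv_into H f y \<in> H" if "y \<in> H'" for y
    using that bij by (auto simp: bij_betw_def f_inv_into_f inv_into_into)
  have f_pulled: "f (pulled G H f c x) = f x \<otimes> c" "pulled G H f c x \<in> H" if "c \<in> C" "x \<in> H" for c x
  proof -
    have "f x \<otimes> c \<in> H'"
      using cay_iso_onD(3)[OF f that(2)] that(1) C(2) by (intro H'.m_closed) auto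
    then show "f (pulled G H f c x) = f x \<otimes> c" "pulled G H f c x \<in> H"
      using finv that by (simp_all add: pulled_def)
  qed
  have inj: "inj_on f H" using bij by (simp add: bij_betw_def)
  have fG: "f x \<in> carrier G" if "x \<in> H" for x using cay_iso_onD(3)[OF f that] by simp
  have aut: "pulled G H f c \<in> carrier (aut_group H (cay_arcs G S))" if c: "c \<in> C" for c
  proof -
    have "cay_iso_on G H S H S (inv_into H f \<circ> ((\<lambda>x. x \<otimes> c) \<circ> f))"
      using cay_iso_on_comp[OF cay_iso_on_comp[OF f cay_iso_on_mult_right[OF H' T]] cay_iso_on_inv[OF f]] c C(2)
      by blast
    moreover have "pulled G H f c = (\<lambda>x. if x \<in> H then (inv_into H f \<circ> ((\<lambda>x. x \<otimes> c) \<circ> f)) x else x)"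
      by (rule ext) (simp only: pulled_def o_apply)
    ultimately show ?thesis by (simp only: aut_cay_iso_on)
  qed
  \<comment> \<open>Right translations compose in reverse order, so this is an antihomomorphism; its
    finite image is closed under composition and hence a subgroup.\<close>
  have mult: "pulled G H f c \<circ> pulled G H f c' = pulled G H f (c' \<otimes> c)" if "c \<in> C" "c' \<in> C" for c c'
  proof
    fix x
    show "(pulled G H f c \<circ> pulled G H f c') x = pulled G H f (c' \<otimes> c) x"
    proof (cases "x \<in> H")
      case True
      then have "f ((pulled G H f c \<circ> pulled G H f c') x) = f (pulled G H f (c' \<otimes> c) x)"
        using f_pulled(1)[OF that(1) f_pulled(2)[OF that(2) True]] f_pulled(1)[OF that(2) True]
          f_pulled(1)[OF C.m_closed[OF that(2,1)] True] fG[OF True] that by (simp add: m_assoc)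
      then show ?thesis
        by (rule inj_onD[OF inj]) (use f_pulled(2) that True in auto)
    qed (simp add: pulled_def)
  qed
  have one: "pulled G H f \<one> = id"
  proof
    fix x show "pulled G H f \<one> x = id x"
      using fG[of x] inv_into_f_f[OF inj, of x] by (auto simp: pulled_def)
  qed
  show ?subg
  proof (rule A.finite_closed_imp_subgroup)
    show "finite (carrier (aut_group H (cay_arcs G S)))" using H by (simp add: finite_aut_group)
    show "\<one>\<^bsub>aut_group H (cay_arcs G S)\<^esub> \<in> pulled G H f ` C" using one C.one_closed by (metis aut_group_simps(2) image_eqI)
    show "pulled G H f ` C \<subseteq> carrier (aut_group H (cay_arcs G S))"
      by (rule image_subsetI) (rule aut)
    fix x y assume "x \<in> pulled G H f ` C" "y \<in> pulled G H f ` C"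
    then obtain c c' where c: "c \<in> C" "c' \<in> C" "x = pulled G H f c" "y = pulled G H f c'"
      by (elim imageE)
    then have "x \<otimes>\<^bsub>aut_group H (cay_arcs G S)\<^esub> y = pulled G H f (c' \<otimes> c)"
      by (simp only: aut_group_simps mult)
    then show "x \<otimes>\<^bsub>aut_group H (cay_arcs G S)\<^esub> y \<in> pulled G H f ` C"
      using C.m_closed[OF c(2,1)] by (simp only: imageI)
  qed
  have "inj_on (pulled G H f) C"
  proof (rule inj_onI)
    fix c c' assume c: "c \<in> C" "c' \<in> C" "pulled G H f c = pulled G H f c'"
    obtain x where x: "x \<in> H" using H by blast
    have "f x \<otimes> c = f x \<otimes> c'" using f_pulled(1)[OF c(1) x] f_pulled(1)[OF c(2) x] c(3) by simp
    then show "c = c'" using fG[OF x] c by simp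
  qed
  then show ?card by (rule card_image)
qed

text \<open>Conjugacy says which translation before \<open>h\<close> produces a given translation
  after it. That assignment is injective on the finite set \<open>C\<close>, hence onto, and can be
  read backwards.\<close>

lemma equivariant_swap:
  assumes C: "finite C" "C \<subseteq> carrier G" and H: "H \<noteq> {}" "\<And>x. x \<in> H \<Longrightarrow> h x \<in> carrier G"
    and eq: "\<And>c. c \<in> C \<Longrightarrow> \<exists>c'\<in>C. \<forall>x\<in>H. h (x \<otimes> c') = h x \<otimes> c" and c: "c \<in> C"
  shows "\<exists>c'\<in>C. \<forall>x\<in>H. h (x \<otimes> c) = h x \<otimes> c'"
proof -
  obtain F where F: "\<And>c. c \<in> C \<Longrightarrow> F c \<in> C" "\<And>c x. c \<in> C \<Longrightarrow> x \<in> H \<Longrightarrow> h (x \<otimes> F c) = h x \<otimes> c"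
    using eq by metis
  obtain x0 where x0: "x0 \<in> H" using H by blast
  have "inj_on F C"
  proof (rule inj_onI)
    fix a b assume ab: "a \<in> C" "b \<in> C" "F a = F b"
    then have "h x0 \<otimes> a = h x0 \<otimes> b" using F(2)[OF _ x0] by metis
    then show "a = b" using ab C H(2)[OF x0] by (metis l_cancel subsetD)
  qed
  then have "F ` C = C" using C(1) F(1) by (intro endo_inj_surj) auto
  then have "c \<in> F ` C" using c by simp
  then obtain c' where c': "c' \<in> C" "c = F c'" by (rule imageE)
  have "\<forall>x\<in>H. h (x \<otimes> c) = h x \<otimes> c'" unfolding c'(2) using F(2)[OF c'(1)] by simp
  then show ?thesis using c'(1) by (rule bexI)
qed

end

section \<open>Subgroups of the dihedral group\<close>

text \<open>Modulo the square of \<open>q\<close>, the power \<open>r ^ l\<close> is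
  \<open>1 + l * (r - 1)\<close>, and the exponents below \<open>q\<close> sum to
  \<open>q * (q - 1) / 2\<close>, a multiple of \<open>q\<close> because \<open>q\<close> is odd.
  For \<open>q = 2\<close> and \<open>r = 3\<close> the sum is 4 and the conclusion fails.\<close>

lemma geometric_sum_odd:
  fixes r :: int
  assumes "odd q" and r: "int q dvd r - 1"
  obtains w where "(\<Sum>l<q. r ^ l) = int q * (1 + int q * w)"
proof -
  obtain t where t: "r = 1 + int q * t" using r by (auto simp: dvd_def algebra_simps)
  obtain m where m: "q = 2 * m + 1" using \<open>odd q\<close> oddE by blast
  have "\<exists>u. r ^ l = 1 + int l * int q * t + (int q)\<^sup>2 * u" for l
  proof (induction l)
    case 0 show ?case by simp
  next
    case (Suc l)
    then obtain u where u: "r ^ l = 1 + int l * int q * t + (int q)\<^sup>2 * u" by blast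
    have "r ^ Suc l = (1 + int q * t) * (1 + int l * int q * t + (int q)\<^sup>2 * u)"
      using u t by simp
    also have "\<dots> = 1 + int (Suc l) * int q * t + (int q)\<^sup>2 * (u + int l * t * t + int q * t * u)"
      by (simp add: algebra_simps power2_eq_square)
    finally show ?case by blast
  qed
  then obtain U where U: "\<And>l. r ^ l = 1 + int l * int q * t + (int q)\<^sup>2 * U l" by metis
  have gauss: "(\<Sum>l<q. int l) = int q * int m"
  proof -
    have "2 * (\<Sum>l<k. int l) = int k * (int k - 1)" for k
      by (induction k) (simp_all add: algebra_simps)
    from this[of q] show ?thesis using m by simp
  qed
  have "(\<Sum>l<q. r ^ l) = int q + (\<Sum>l<q. int l) * int q * t + (int q)\<^sup>2 * (\<Sum>l<q. U l)"
    unfolding U by (simp add: sum.distrib sum_distrib_left sum_distrib_right)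
  also have "\<dots> = int q * (1 + int q * (int m * t + (\<Sum>l<q. U l)))"
    unfolding gauss by (simp add: algebra_simps power2_eq_square)
  finally show thesis using that by blast
qed

text \<open>By Fermat, \<open>r ^ q\<close> and \<open>r\<close> agree modulo \<open>q\<close>; the
  residue \<open>a\<close> provides the natural number that \<open>fermat_theorem\<close>
  expects.\<close>

lemma prime_dvd_power_self_diff_one:
  fixes r :: int
  assumes q: "Factorial_Ring.prime q" and "int q dvd r ^ q - 1"
  shows "int q dvd r - 1"
proof -
  define a where "a = nat (r mod int q)"
  have q0: "q > 0" using q prime_gt_0_nat by blast
  then have a: "int a = r mod int q" by (simp add: a_def)
  have ra: "[r = int a] (mod int q)" by (simp add: a cong_def)
  have "[a ^ q = a] (mod q)"
  proof (cases "q dvd a")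
    case True
    then have "q dvd a ^ q" using q0 by (intro dvd_trans[OF True dvd_power]) simp
    then show ?thesis using True by (simp add: cong_def)
  next
    case False
    then have "[a ^ (q - 1) * a = 1 * a] (mod q)" using fermat_theorem[OF q] cong_scalar_right by blast
    then show ?thesis unfolding power_minus_mult[OF q0] by simp
  qed
  then have "[int a ^ q = int a] (mod int q)" by (metis cong_int_iff of_nat_power)
  then have "[r ^ q = r] (mod int q)" using ra by (meson cong_pow cong_sym cong_trans)
  moreover have "[r ^ q = 1] (mod int q)" using assms(2) by (simp add: cong_iff_dvd_diff)
  ultimately have "[r = 1] (mod int q)" by (meson cong_sym cong_trans)
  then show ?thesis by (simp add: cong_iff_dvd_diff)
qed

context dih begin

section \<open>Rotation parts of subgroups\<close>

definition rotsub :: "nat \<Rightarrow> (nat \<times> nat) set" where "rotsub d = rot ` {x. int d dvd x}"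

definition rot_part :: "nat \<Rightarrow> (nat \<times> nat) set \<Rightarrow> bool" where
  "rot_part d H \<longleftrightarrow> (\<forall>x. rot x \<in> H \<longleftrightarrow> int d dvd x)"

lemma rot_cong_mod: "rot (a * (i mod int n)) = rot (a * i)"
  by (simp add: rot_eq_iff mod_eq_dvd_iff[symmetric] mod_mult_right_eq)

text \<open>Division with remainder by the least positive exponent occurring in \<open>H\<close>.
  The exponent \<open>n\<close> always occurs, so the minimum exists, and \<open>d = n\<close> is
  the case of a trivial rotation part.\<close>

lemma subgroup_rot_part:
  assumes H: "subgroup H G"
  obtains d N where "n = d * N" "rot_part d H"
proof -
  interpret H: subgroup H G by fact
  have one: "rot 0 \<in> H" using H.one_closed by (simp add: dihedral_one)
  have add: "rot (x + y) \<in> H" if "rot x \<in> H" "rot y \<in> H" for x y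
    using H.m_closed[OF that] by simp
  have mult: "rot (c * x) \<in> H" if x: "rot x \<in> H" for c x
  proof -
    have nat: "rot (int j * x) \<in> H" for j
    proof (induction j)
      case (Suc j)
      from add[OF this x] show ?case by (simp add: distrib_right add.commute)
    qed (use one in simp)
    from nat[of "nat (c mod int n)"] show ?thesis
      using n_pos rot_cong_mod[of x c] by (simp add: mult.commute)
  qed
  define d where "d = (LEAST m. 0 < m \<and> rot (int m) \<in> H)"
  have "rot (int n) = rot 0" by (simp add: rot_eq_iff)
  then have "0 < n \<and> rot (int n) \<in> H" using n_ge_3 one by simp
  then have d: "0 < d" "rot (int d) \<in> H"
    unfolding d_def using LeastI[of "\<lambda>m. 0 < m \<and> rot (int m) \<in> H" n] by auto
  have iff: "rot x \<in> H \<longleftrightarrow> int d dvd x" for x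
  proof
    assume x: "rot x \<in> H"
    have "x mod int d = x + - (x div int d) * int d"
      using div_mult_mod_eq[of x "int d"] by (simp only: mult_minus_left)
    then have r: "rot (x mod int d) \<in> H" using add[OF x mult[OF d(2)]] by metis
    show "int d dvd x"
    proof (rule ccontr)
      assume "\<not> int d dvd x"
      then have "x mod int d \<noteq> 0" by (simp add: mod_eq_0_iff_dvd)
      then have "0 < x mod int d" using pos_mod_sign[of "int d" x] d(1) by linarith
      then have "0 < nat (x mod int d) \<and> rot (int (nat (x mod int d))) \<in> H" using r by simp
      then have "d \<le> nat (x mod int d)" unfolding d_def by (rule Least_le)
      then show False using d(1) pos_mod_bound[of "int d" x] by linarith
    qed
  next
    assume "int d dvd x"
    then obtain c where "x = c * int d" by (metis dvdE mult.commute)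
    then show "rot x \<in> H" using mult[OF d(2)] by simp
  qed
  have "int d dvd int n" using iff one \<open>rot (int n) = rot 0\<close> by metis
  then obtain N where "n = d * N" by auto
  moreover have "rot_part d H" using iff by (simp add: rot_part_def)
  ultimately show thesis using that by blast
qed

lemma rotsub_simp:
  assumes "int d dvd int n" shows "rot x \<in> rotsub d \<longleftrightarrow> int d dvd x"
proof
  assume "rot x \<in> rotsub d"
  then obtain y where y: "int d dvd y" "int n dvd x - y" by (auto simp: rotsub_def rot_eq_iff)
  then have "int d dvd (x - y) + y" using assms dvd_trans dvd_add by blast
  then show "int d dvd x" by simp
qed (auto simp: rotsub_def)

lemma rotsub_subgroup: "subgroup (rotsub d) G"
proof (rule finite_closed_imp_subgroup[OF finite_dihedral])
  show "\<one>\<^bsub>G\<^esub> \<in> rotsub d" by (auto simp: rotsub_def dihedral_one)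
  show "x \<otimes>\<^bsub>G\<^esub> y \<in> rotsub d" if "x \<in> rotsub d" "y \<in> rotsub d" for x y
    using that by (auto simp: rotsub_def)
qed (auto simp: rotsub_def)

lemma card_rotsub:
  assumes "n = d * N" shows "card (rotsub d) = N"
proof -
  have d0: "d > 0" "N > 0" using assms n_ge_3 by (auto intro: Nat.gr0I)
  have n: "int n dvd a * int d \<longleftrightarrow> int N dvd a" for a using d0 by (simp add: assms mult.commute[of a])
  have "rotsub d = (\<lambda>j. rot (int j * int d)) ` {..<N}" (is "_ = ?R")
  proof
    show "rotsub d \<subseteq> ?R"
    proof
      fix g assume "g \<in> rotsub d"
      then obtain c where g: "g = rot (c * int d)" by (auto simp: rotsub_def dvd_def mult.commute)
      have "int n dvd (c - c mod int N) * int d" unfolding n by (metis mod_eq_dvd_iff mod_mod_trivial)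
      then have "g = rot (int (nat (c mod int N)) * int d)"
        using d0 by (simp add: g rot_eq_iff left_diff_distrib)
      then show "g \<in> ?R" using d0 by (intro image_eqI[of _ _ "nat (c mod int N)"]) (auto simp: nat_less_iff)
    qed
  qed (auto simp: rotsub_def)
  moreover have "inj_on (\<lambda>j. rot (int j * int d)) {..<N}"
  proof (rule inj_onI)
    fix i j assume *: "i \<in> {..<N}" "j \<in> {..<N}" "rot (int i * int d) = rot (int j * int d)"
    then have "int n dvd (int i - int j) * int d" by (simp add: rot_eq_iff left_diff_distrib)
    then have "int i mod int N = int j mod int N" unfolding n by (simp add: mod_eq_dvd_iff)
    then show "i = j" using * by simp
  qed
  ultimately show ?thesis by (simp add: card_image)
qed

text \<open>The product of two reflections is the rotation by the difference of their
  exponents.\<close>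

lemma subgroup_refl_iff:
  assumes "subgroup H G" "rot_part d H" "refl i \<in> H"
  shows "refl j \<in> H \<longleftrightarrow> int d dvd i - j"
proof
  interpret H: subgroup H G by fact
  show "int d dvd i - j" if "refl j \<in> H"
    using H.m_closed[OF assms(3) that] assms(2) by (simp add: rot_part_def)
  assume "int d dvd i - j"
  then have "rot (i - j) \<in> H" using assms(2) by (simp add: rot_part_def)
  from H.m_closed[OF assms(3) this] show "refl j \<in> H" by simp
qed

lemma card_subgroup_refl:
  assumes H: "subgroup H G" "rot_part d H" and n: "n = d * N"
  shows "(\<nexists>i. refl i \<in> H) \<Longrightarrow> H = rotsub d"
    and "refl i \<in> H \<Longrightarrow> H = rotsub d \<union> (\<lambda>g. refl i \<otimes>\<^bsub>G\<^esub> g) ` rotsub d"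
    and "refl i \<in> H \<Longrightarrow> card H = 2 * N"
proof -
  have sub: "H \<subseteq> carrier G" using H(1) subgroup.subset by blast
  have dn: "int d dvd int n" using n by simp
  have rot_iff: "rot x \<in> rotsub d \<longleftrightarrow> rot x \<in> H" for x
    using H(2) rotsub_simp[OF dn] by (simp add: rot_part_def)
  have rs: "rotsub d \<subseteq> H" using H(2) by (auto simp: rotsub_def rot_part_def)
  show "H = rotsub d" if no: "\<nexists>i. refl i \<in> H"
  proof
    show "H \<subseteq> rotsub d"
    proof
      fix g assume g: "g \<in> H"
      then have "g \<in> carrier G" using sub by blast
      then show "g \<in> rotsub d" by (cases g rule: dihedral_cases) (use g no rot_iff in auto)
    qed
  qed (rule rs)
  assume i: "refl i \<in> H"
  have "H \<subseteq> rotsub d \<union> (\<lambda>g. refl i \<otimes>\<^bsub>G\<^esub> g) ` rotsub d"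
  proof
    fix g assume g: "g \<in> H"
    then have "g \<in> carrier G" using sub by blast
    then show "g \<in> rotsub d \<union> (\<lambda>g. refl i \<otimes>\<^bsub>G\<^esub> g) ` rotsub d"
    proof (cases g rule: dihedral_cases)
      case (rot x) then show ?thesis using g rot_iff by simp
    next
      case (refl j)
      then have "int d dvd i - j" using g subgroup_refl_iff[OF H i] by simp
      then have "rot (i - j) \<in> rotsub d" using rotsub_simp[OF dn] by simp
      moreover have "g = refl i \<otimes>\<^bsub>G\<^esub> rot (i - j)" using refl by simp
      ultimately show ?thesis by blast
    qed
  qed
  moreover have "(\<lambda>g. refl i \<otimes>\<^bsub>G\<^esub> g) ` rotsub d \<subseteq> H"
    using rs i subgroup.m_closed[OF H(1)] by blast
  ultimately show eq: "H = rotsub d \<union> (\<lambda>g. refl i \<otimes>\<^bsub>G\<^esub> g) ` rotsub d" using rs by blast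
  have fin: "finite (rotsub d)" using rs sub finite_dihedral finite_subset by metis
  have "rotsub d \<inter> (\<lambda>g. refl i \<otimes>\<^bsub>G\<^esub> g) ` rotsub d = {}" by (auto simp: rotsub_def)
  moreover have "inj_on (\<lambda>g. refl i \<otimes>\<^bsub>G\<^esub> g) (rotsub d)"
    using subgroup.subset[OF rotsub_subgroup] by (intro inj_onI) (auto simp: subset_iff)
  ultimately have "card (rotsub d \<union> (\<lambda>g. refl i \<otimes>\<^bsub>G\<^esub> g) ` rotsub d) = card (rotsub d) + card (rotsub d)"
    using fin by (subst card_Un_disjoint) (auto simp: card_image)
  then show "card H = 2 * N" using eq card_rotsub[OF n] by simp
qed

text \<open>The translation \<open>c'\<close> depends on \<open>c\<close> alone and not on
  \<open>x\<close>, so the image of the generator \<open>rot d\<close> fixes one multiplier valid on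
  all cosets at once.\<close>

lemma equivariant_linear:
  assumes H: "subgroup H G" "rot_part d H" and dn: "int d dvd int n"
    and hG: "\<And>x. x \<in> H \<Longrightarrow> h x \<in> carrier G"
    and eq: "\<And>c. c \<in> rotsub d \<Longrightarrow> \<exists>c'\<in>rotsub d. \<forall>x\<in>H. h (x \<otimes>\<^bsub>G\<^esub> c) = h x \<otimes>\<^bsub>G\<^esub> c'"
  obtains r where "\<And>x y. x \<in> H \<Longrightarrow> int d dvd y \<Longrightarrow> h (x \<otimes>\<^bsub>G\<^esub> rot y) = h x \<otimes>\<^bsub>G\<^esub> rot (r * y)"
proof -
  interpret H: subgroup H G by fact
  have "rot (int d) \<in> rotsub d" using rotsub_simp[OF dn] by simp
  then obtain c' where "c' \<in> rotsub d" "\<forall>x\<in>H. h (x \<otimes>\<^bsub>G\<^esub> rot (int d)) = h x \<otimes>\<^bsub>G\<^esub> c'"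
    using eq by blast
  then obtain r where r: "\<And>x. x \<in> H \<Longrightarrow> h (x \<otimes>\<^bsub>G\<^esub> rot (int d)) = h x \<otimes>\<^bsub>G\<^esub> rot (r * int d)"
    by (auto simp: rotsub_def dvd_def mult.commute)
  have nat: "h (x \<otimes>\<^bsub>G\<^esub> rot (int d * int j)) = h x \<otimes>\<^bsub>G\<^esub> rot (r * int d * int j)" if x: "x \<in> H" for x j
  proof (induction j)
    case 0
    have "h x \<otimes>\<^bsub>G\<^esub> rot 0 = h x" "x \<otimes>\<^bsub>G\<^esub> rot 0 = x"
      using hG[OF x] H.mem_carrier[OF x] by (simp_all add: dihedral_one[symmetric])
    then show ?case by simp
  next
    case (Suc j)
    have "rot (int d * int j) \<in> H" using H(2) by (simp add: rot_part_def)
    then have xH: "x \<otimes>\<^bsub>G\<^esub> rot (int d * int j) \<in> H" using x by (rule H.m_closed[rotated])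
    have "x \<otimes>\<^bsub>G\<^esub> rot (int d * int (Suc j)) = x \<otimes>\<^bsub>G\<^esub> (rot (int d * int j) \<otimes>\<^bsub>G\<^esub> rot (int d))"
      by (simp add: algebra_simps)
    also have "\<dots> = x \<otimes>\<^bsub>G\<^esub> rot (int d * int j) \<otimes>\<^bsub>G\<^esub> rot (int d)"
      using H.mem_carrier[OF x] by (simp only: m_assoc rot_in_carrier)
    finally have "h (x \<otimes>\<^bsub>G\<^esub> rot (int d * int (Suc j)))
        = h x \<otimes>\<^bsub>G\<^esub> rot (r * int d * int j) \<otimes>\<^bsub>G\<^esub> rot (r * int d)"
      using r[OF xH] Suc by simp
    also have "\<dots> = h x \<otimes>\<^bsub>G\<^esub> (rot (r * int d * int j) \<otimes>\<^bsub>G\<^esub> rot (r * int d))"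
      using hG[OF x] by (simp only: m_assoc rot_in_carrier)
    also have "\<dots> = h x \<otimes>\<^bsub>G\<^esub> rot (r * int d * int (Suc j))" by (simp add: algebra_simps)
    finally show ?case .
  qed
  have "h (x \<otimes>\<^bsub>G\<^esub> rot y) = h x \<otimes>\<^bsub>G\<^esub> rot (r * y)" if x: "x \<in> H" and y: "int d dvd y" for x y
  proof -
    obtain c where c: "y = int d * c" using y by blast
    define j where "j = nat (c mod int n)"
    have j: "int j = c mod int n" using n_pos by (simp add: j_def)
    have "rot y = rot (int d * int j)" "rot (r * y) = rot (r * int d * int j)"
      using rot_cong_mod[of "int d" c] rot_cong_mod[of "r * int d" c] by (simp_all add: c j mult.assoc)
    then show ?thesis using nat[OF x, of j] by simp
  qed
  then show thesis using that by blast
qed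

text \<open>The injective map \<open>h\<close> sends the finite set \<open>rotsub d\<close> into
  itself, hence onto itself, so no rotation is left over as the value at a reflection.\<close>

lemma image_refl:
  assumes H: "subgroup H G" "rot_part d H" and H': "H' \<subseteq> carrier G" "rot_part d H'" and dn: "int d dvd int n"
    and h: "inj_on h H" "\<And>x. x \<in> H \<Longrightarrow> h x \<in> H'"
    and rot: "\<And>y. int d dvd y \<Longrightarrow> h (rot y) = rot (r * y)" and i: "refl i \<in> H"
  obtains i' where "h (refl i) = refl i'"
proof -
  have "h (refl i) \<in> carrier G" using h(2)[OF i] H'(1) by blast
  then show thesis
  proof (cases rule: dihedral_cases)
    case (rot y)
    have sub: "rotsub d \<subseteq> H" using H(2) by (auto simp: rotsub_def rot_part_def)
    have "h ` rotsub d \<subseteq> rotsub d" using assms(8) by (auto simp: rotsub_def)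
    moreover have "finite (rotsub d)"
      using finite_subset[OF subgroup.subset[OF rotsub_subgroup] finite_dihedral] .
    ultimately have "h ` rotsub d = rotsub d" using inj_on_subset[OF h(1) sub] by (intro endo_inj_surj)
    moreover have "h (refl i) \<in> rotsub d"
      using rot h(2)[OF i] H'(2) rotsub_simp[OF dn] by (simp add: rot_part_def)
    ultimately obtain c where "c \<in> rotsub d" "h c = h (refl i)" by (metis imageE)
    then have "c = refl i" using inj_onD[OF h(1)] sub i by blast
    then show thesis using \<open>c \<in> rotsub d\<close> by (auto simp: rotsub_def)
  qed (use that in blast)
qed

lemma rot_commute:
  assumes "w \<in> carrier G"
  obtains e' where "e' = e \<or> e' = - e" "w \<otimes>\<^bsub>G\<^esub> rot e = rot e' \<otimes>\<^bsub>G\<^esub> w" "rot e \<otimes>\<^bsub>G\<^esub> w = w \<otimes>\<^bsub>G\<^esub> rot e'"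
  using assms
proof (cases w rule: dihedral_cases)
  case (rot x) then show thesis using that[of e] by (simp add: algebra_simps)
next
  case (refl x) then show thesis using that[of "- e"] by (simp add: algebra_simps)
qed

lemma pulled_id: "x \<in> H \<Longrightarrow> x \<otimes>\<^bsub>G\<^esub> c \<in> H \<Longrightarrow> pulled G H (\<lambda>x. x) c x = x \<otimes>\<^bsub>G\<^esub> c"
  using inv_into_f_f[of "\<lambda>x. x" H] by (simp add: pulled_def)

end

section \<open>Large vertex stabilizers\<close>

locale dih_prime_power = dih +
  fixes q k :: nat
  assumes prime_q: "Factorial_Ring.prime q" and odd_q: "odd q" and n_eq: "n = q ^ k"
begin

lemma q_gt_1: "q > 1" using prime_q prime_gt_1_nat by blast

lemma divisor_of_n:
  assumes "n = d * N" shows "\<exists>j. N = q ^ j" and "N \<noteq> 1 \<Longrightarrow> q dvd N"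
proof -
  have "N dvd q ^ k" using assms n_eq by simp
  then obtain j where j: "N = q ^ j" using divides_primepow_nat[OF prime_q] by blast
  then show "\<exists>j. N = q ^ j" by blast
  show "q dvd N" if "N \<noteq> 1" using that j by (cases j) auto
qed

lemma coprime_n: "\<not> int q dvd u \<Longrightarrow> coprime u (int n)"
proof -
  assume "\<not> int q dvd u"
  then have "coprime (int q) u" using prime_q by (intro prime_imp_coprime) auto
  then show "coprime u (int n)" by (simp add: n_eq coprime_commute)
qed

text \<open>By \<open>geometric_sum_odd\<close> the sum is \<open>q\<close> times a number congruent
  to 1 modulo \<open>q\<close>, which is invertible modulo the power \<open>n\<close> of
  \<open>q\<close>.\<close>

lemma shift_dvd:
  assumes "int n dvd s * (\<Sum>l<q. r ^ l)" "int q dvd r - 1"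
  shows "int n dvd int q * s"
proof -
  obtain w where w: "(\<Sum>l<q. r ^ l) = int q * (1 + int q * w)"
    using geometric_sum_odd[OF odd_q assms(2)] .
  have "\<not> int q dvd 1 + int q * w"
    using q_gt_1 zdvd_imp_le[of "int q" 1] by (simp add: dvd_add_left_iff)
  then have "coprime (1 + int q * w) (int n)" by (rule coprime_n)
  moreover have "int n dvd (int q * s) * (1 + int q * w)" using assms(1) w by (simp add: ac_simps)
  ultimately show ?thesis by (simp add: coprime_dvd_mult_left_iff coprime_commute)
qed

text \<open>Iterating an affine map \<open>q\<close> times accumulates its displacement with the
  factor \<open>1 + r + \<dots> + r ^ (q - 1)\<close>. As \<open>z ^^ q = id\<close>, the total
  vanishes modulo \<open>n\<close>, and \<open>shift_dvd\<close> replaces the factor by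
  \<open>q\<close>.\<close>

lemma normalizing_automorphism_shift:
  assumes H: "subgroup H G" "rot_part d H" and n: "n = d * N"
    and z: "inj_on z H" "\<And>x. x \<in> H \<Longrightarrow> z x \<in> H" "z (rot 0) = rot 0" "z ^^ q = id"
    and eq: "\<And>c. c \<in> rotsub d \<Longrightarrow> \<exists>c'\<in>rotsub d. \<forall>x\<in>H. z (x \<otimes>\<^bsub>G\<^esub> c) = z x \<otimes>\<^bsub>G\<^esub> c'"
    and x: "x \<in> H"
  shows "\<exists>e. int n dvd int q * e \<and> z x = x \<otimes>\<^bsub>G\<^esub> rot e"
proof -
  interpret H: subgroup H G by fact
  have dn: "int d dvd int n" using n by simp
  have d0: "d > 0" using n n_ge_3 by (auto intro: Nat.gr0I)
  obtain r where r: "\<And>x y. x \<in> H \<Longrightarrow> int d dvd y \<Longrightarrow> z (x \<otimes>\<^bsub>G\<^esub> rot y) = z x \<otimes>\<^bsub>G\<^esub> rot (r * y)"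
    using equivariant_linear[OF H dn _ eq] z(2) H.mem_carrier by metis
  have rot0: "rot 0 \<in> H" using H.one_closed by (simp add: dihedral_one)
  have zrot: "z (rot y) = rot (r * y)" if "int d dvd y" for y
    using r[OF rot0 that] z(3) by simp
  have zl: "(z ^^ l) (rot (int d)) = rot (r ^ l * int d)" for l
    by (induction l) (simp_all add: zrot mult.assoc)
  have "int n dvd r ^ q * int d - int d"
    using zl[of q] z(4) by (simp add: rot_eq_iff dvd_diff_commute)
  then have "int d * int N dvd int d * (r ^ q - 1)" by (simp add: n algebra_simps)
  then have Nr: "int N dvd r ^ q - 1" using d0 by simp
  \<comment> \<open>For \<open>N = 1\<close> nothing is known about \<open>r\<close>, but then
    \<open>d = n\<close> and every displacement is a multiple of \<open>n\<close>; below, that case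
    is treated apart.\<close>
  have q_r: "int q dvd r - 1" if "N \<noteq> 1"
  proof -
    have "int q dvd int N" using divisor_of_n(2)[OF n that] by simp
    then show ?thesis using Nr dvd_trans prime_dvd_power_self_diff_one[OF prime_q] by blast
  qed
  show ?thesis using H.mem_carrier[OF x]
  proof (cases x rule: dihedral_cases)
    case (rot y)
    then have y: "int d dvd y" using x H(2) by (simp add: rot_part_def)
    have "int n dvd int q * ((r - 1) * y)"
    proof (cases "N = 1")
      case True then show ?thesis using y n by (simp add: dvd_mult)
    next
      case False
      \<comment> \<open>On rotations the displacement of \<open>rot d\<close> is
        \<open>(r - 1) * d\<close>, and factoring \<open>r ^ q - 1\<close> exhibits the geometric
        sum.\<close>
      have "int n dvd ((r - 1) * int d) * (\<Sum>l<q. r ^ l)"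
      proof -
        have "int n dvd int d * (r ^ q - 1)" using Nr by (simp add: n)
        moreover have "int d * (r ^ q - 1) = ((r - 1) * int d) * (\<Sum>l<q. r ^ l)"
          by (simp add: power_diff_1_eq)
        ultimately show ?thesis by metis
      qed
      then have "int n dvd int q * ((r - 1) * int d)" using q_r[OF False] by (rule shift_dvd)
      moreover have "int q * ((r - 1) * int d) dvd int q * ((r - 1) * y)" using y by (intro mult_dvd_mono) auto
      ultimately show ?thesis by (rule dvd_trans)
    qed
    moreover have "z x = x \<otimes>\<^bsub>G\<^esub> rot ((r - 1) * y)" using rot zrot[OF y] by (simp add: algebra_simps)
    ultimately show ?thesis by blast
  next
    case (refl i)
    then have iH: "refl i \<in> H" using x by simp
    obtain i' where i': "z (refl i) = refl i'"
      using image_refl[OF H H.subset H(2) dn z(1,2) zrot iH] by blast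
    define s where "s = i' - i"
    have i's: "i' = i + s" by (simp add: s_def)
    have "int d dvd i - i'" using subgroup_refl_iff[OF H iH] z(2)[OF iH] i' by simp
    then have ds: "int d dvd s" by (simp add: s_def dvd_diff_commute)
    have zrefl: "z (refl (i + y)) = refl (i + s + r * y)" if "int d dvd y" for y
      using r[OF iH, of "- y"] that i' i's by simp
    have zl': "(z ^^ l) (refl i) = refl (i + s * (\<Sum>j<l. r ^ j))" for l
    proof (induction l)
      case (Suc l)
      have "(z ^^ Suc l) (refl i) = refl (i + s + r * (s * (\<Sum>j<l. r ^ j)))"
        using Suc zrefl ds by simp
      also have "i + s + r * (s * (\<Sum>j<l. r ^ j)) = i + s * (\<Sum>j<Suc l. r ^ j)"
        by (simp add: sum.lessThan_Suc_shift sum_distrib_left algebra_simps del: sum.lessThan_Suc)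
      finally show ?case .
    qed simp
    have "refl i = refl (i + s * (\<Sum>j<q. r ^ j))" using zl'[of q] z(4) by simp
    then have *: "int n dvd s * (\<Sum>j<q. r ^ j)" by (simp add: refl_eq_iff)
    have "int n dvd int q * s"
    proof (cases "N = 1")
      case True then show ?thesis using ds n by (simp add: dvd_mult)
    next
      case False then show ?thesis using shift_dvd[OF * q_r] by simp
    qed
    then show ?thesis using i' i's refl by (intro exI[of _ "- s"]) simp
  qed
qed

text \<open>The subgroup \<open>Q\<close> of order \<open>q\<close>, as the rotations whose
  \<open>q\<close>-th power is trivial.\<close>

definition rot_q :: "(nat \<times> nat) set" where "rot_q = rot ` {e. int n dvd int q * e}"

lemma card_rot_q: "finite rot_q" "card rot_q \<le> q"
proof -
  have "k \<noteq> 0" using n_eq n_ge_3 by (intro notI) simp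
  then obtain m where m: "int n = int q * m" by (cases k) (auto simp: n_eq)
  have q0: "int q > 0" using q_gt_1 by simp
  have "rot_q \<subseteq> (\<lambda>j. rot (m * int j)) ` {..<q}"
  proof
    fix g assume "g \<in> rot_q"
    then obtain e where e: "g = rot e" "int q * m dvd int q * e" by (auto simp: rot_q_def m)
    then obtain c where c: "e = m * c" using q0 by (auto simp: dvd_def)
    have "int q * m dvd m * (c - c mod int q)"
      using mult_dvd_mono[OF dvd_refl, of "int q" "c - c mod int q" m]
      by (simp add: mult.commute mod_eq_dvd_iff[symmetric])
    then have "g = rot (m * int (nat (c mod int q)))"
      using q0 by (simp add: e c rot_eq_iff m right_diff_distrib)
    then show "g \<in> (\<lambda>j. rot (m * int j)) ` {..<q}"
      using q0 by (intro image_eqI[of _ _ "nat (c mod int q)"]) (auto simp: nat_less_iff)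
  qed
  then show "finite rot_q" "card rot_q \<le> q"
    using finite_subset surj_card_le[of "{..<q}" rot_q] by auto
qed

text \<open>If two iterates agree at \<open>y\<close>, some power of \<open>z\<close> with exponent
  prime to \<open>q\<close> fixes \<open>y\<close>; by Bezout and \<open>z ^^ q = id\<close>, so
  does \<open>z\<close> itself.\<close>

lemma funpow_prime_orbit:
  assumes "z ^^ q = id" "inj z" "z y \<noteq> y"
  shows "inj_on (\<lambda>l. (z ^^ l) y) {..<q}"
proof (rule linorder_inj_onI')
  fix i j assume ij: "i \<in> {..<q}" "j \<in> {..<q}" "i < j"
  show "(z ^^ i) y \<noteq> (z ^^ j) y"
  proof
    assume "(z ^^ i) y = (z ^^ j) y"
    moreover have "(z ^^ j) y = (z ^^ i) ((z ^^ (j - i)) y)"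
      using ij by (simp add: funpow_add[symmetric, THEN fun_cong, simplified])
    ultimately have fixed: "(z ^^ (j - i)) y = y" using inj_fn[OF assms(2), of i] by (simp add: inj_def)
    have "coprime (j - i) q"
    proof (rule coprime_commute[THEN iffD1, OF prime_imp_coprime[OF prime_q]])
      show "\<not> q dvd j - i" using ij dvd_imp_le[of q "j - i"] by auto
    qed
    moreover have "j - i \<noteq> 0" using ij by simp
    ultimately obtain a b where ab: "(j - i) * a = q * b + 1"
      using bezout_nat[of "j - i" q] by auto
    have "((z ^^ (j - i)) ^^ a) y = y" by (induction a) (simp_all add: fixed)
    moreover have "(z ^^ (q * b + 1)) y = z y"
      using assms(1) by (simp add: funpow_add funpow_mult[symmetric])
    ultimately show False using assms(3) ab by (simp add: funpow_mult)
  qed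
qed

text \<open>If \<open>C\<close> is not a full Sylow subgroup, an automorphism of order \<open>q\<close> that normalizes \<open>C\<close>
  and fixes the identity only moves points within cosets of the subgroup of order \<open>q\<close>.\<close>

lemma large_stabilizer_imp_coset:
  assumes S: "S \<subseteq> carrier G" "card S \<le> q" and rp: "rot_part d (reach G S)" and n: "n = d * N"
    and dvd: "q * N dvd order (aut_group (reach G S) (cay_arcs G S))"
  obtains s where "s \<in> S" "S = (\<lambda>\<kappa>. s \<otimes>\<^bsub>G\<^esub> \<kappa>) ` rot_q"
proof -
  define H where "H = reach G S"
  define C where "C = rotsub d"
  define A where "A = aut_group H (cay_arcs G S)"
  have H: "subgroup H G" "rot_part d H"
    using reach_subgroup[OF finite_dihedral S(1)] rp by (simp_all add: H_def)
  interpret H: subgroup H G by (rule H)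
  interpret A: group A unfolding A_def by (rule group_aut_group)
  have dn: "int d dvd int n" using n by simp
  have N0: "N > 0" using n n_ge_3 by (auto intro: Nat.gr0I)
  have finH: "finite H" using H.subset finite_dihedral finite_subset by blast
  have finA: "finite (carrier A)" unfolding A_def by (rule finite_aut_group[OF finH])
  have A_mult: "x \<otimes>\<^bsub>A\<^esub> y = x \<circ> y" "\<one>\<^bsub>A\<^esub> = id" for x y by (simp_all add: A_def)
  have CH: "C \<subseteq> H" using H(2) by (auto simp: C_def rotsub_def rot_part_def)
  have C: "subgroup C G" unfolding C_def by (rule rotsub_subgroup)
  interpret C: subgroup C G by (rule C)
  have cC: "card C = N" unfolding C_def by (rule card_rotsub[OF n])
  have rot0: "rot 0 \<in> H" using H.one_closed by (simp add: dihedral_one)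
  define \<rho> where "\<rho> = pulled G H (\<lambda>x. x)"
  have \<rho>: "\<rho> c x = x \<otimes>\<^bsub>G\<^esub> c" if "c \<in> C" "x \<in> H" for c x
    unfolding \<rho>_def using that CH by (intro pulled_id) auto
  have \<rho>_out: "\<rho> c x = x" if "x \<notin> H" for c x using that by (simp add: \<rho>_def pulled_def)
  define R where "R = \<rho> ` C"
  have id: "cay_iso_on G H S H S (\<lambda>x. x)" by (simp add: cay_iso_on_def bij_betw_def)
  have R: "subgroup R A" "card R = N"
    unfolding R_def \<rho>_def A_def
    using pulled_subgroup[OF id finH _ H(1) S(1) C CH] rot0 cC by auto
  obtain j where j: "N = q ^ j" using divisor_of_n(1)[OF n] by blast
  \<comment> \<open>The normalizer in \<open>A\<close> of the right translations by
    \<open>C\<close>.\<close>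
  define M where "M = {g \<in> carrier A. \<forall>r\<in>R. \<exists>k\<in>R. r \<otimes>\<^bsub>A\<^esub> g = g \<otimes>\<^bsub>A\<^esub> k}"
  have cM: "q * N dvd card M"
    unfolding M_def using A.card_normalizer_dvd[OF finA R(1) prime_q, of j] R(2) j dvd
    by (simp add: A_def H_def)
  interpret R: subgroup R A by (rule R)
  have M: "subgroup M A"
  proof (rule A.finite_closed_imp_subgroup[OF finA])
    show "\<one>\<^bsub>A\<^esub> \<in> M" using A.l_one A.r_one R.mem_carrier by (auto simp: M_def)
    show "g \<otimes>\<^bsub>A\<^esub> h \<in> M" if "g \<in> M" "h \<in> M" for g h
    proof -
      have gh: "g \<in> carrier A" "h \<in> carrier A" using that by (auto simp: M_def)
      have "\<exists>k\<in>R. r \<otimes>\<^bsub>A\<^esub> (g \<otimes>\<^bsub>A\<^esub> h) = g \<otimes>\<^bsub>A\<^esub> h \<otimes>\<^bsub>A\<^esub> k" if r: "r \<in> R" for r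
      proof -
        obtain k1 where k1: "k1 \<in> R" "r \<otimes>\<^bsub>A\<^esub> g = g \<otimes>\<^bsub>A\<^esub> k1" using \<open>g \<in> M\<close> r unfolding M_def by blast
        obtain k2 where k2: "k2 \<in> R" "k1 \<otimes>\<^bsub>A\<^esub> h = h \<otimes>\<^bsub>A\<^esub> k2" using \<open>h \<in> M\<close> k1(1) unfolding M_def by blast
        have "r \<otimes>\<^bsub>A\<^esub> (g \<otimes>\<^bsub>A\<^esub> h) = g \<otimes>\<^bsub>A\<^esub> h \<otimes>\<^bsub>A\<^esub> k2"
          using k1(2) k2(2) by (simp only: A_mult) (metis comp_assoc)
        then show ?thesis using k2(1) by blast
      qed
      then show ?thesis using gh by (simp add: M_def)
    qed
  qed (auto simp: M_def)
  interpret M: subgroup M A by (rule M)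
  have R_M: "\<rho> c \<in> M" if c: "c \<in> C" for c
  proof -
    have "\<rho> c' \<otimes>\<^bsub>A\<^esub> \<rho> c = \<rho> c \<otimes>\<^bsub>A\<^esub> \<rho> c'" if c': "c' \<in> C" for c'
    proof -
      have "\<rho> c' (\<rho> c x) = \<rho> c (\<rho> c' x)" for x
      proof (cases "x \<in> H")
        case True
        have xc: "x \<otimes>\<^bsub>G\<^esub> c \<in> H" "x \<otimes>\<^bsub>G\<^esub> c' \<in> H" using True c c' CH by auto
        have "c \<otimes>\<^bsub>G\<^esub> c' = c' \<otimes>\<^bsub>G\<^esub> c" using c c' by (auto simp: C_def rotsub_def add.commute)
        then show ?thesis using xc True c c' by (simp add: \<rho> m_assoc)
      qed (simp add: \<rho>_out)
      then show ?thesis by (auto simp: A_mult)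
    qed
    then have "\<forall>r\<in>R. \<exists>k\<in>R. r \<otimes>\<^bsub>A\<^esub> \<rho> c = \<rho> c \<otimes>\<^bsub>A\<^esub> k"
      unfolding R_def by blast
    moreover have "\<rho> c \<in> carrier A" using c R.mem_carrier by (simp add: R_def)
    ultimately show ?thesis by (simp only: M_def mem_Collect_eq)
  qed
  have autM: "g permutes H" "x \<in> H \<Longrightarrow> g x \<in> H" if "g \<in> M" for g x
  proof -
    have "g \<in> carrier (aut_group H (cay_arcs G S))"
      using M.mem_carrier[OF that] by (simp only: A_def)
    then show "g permutes H" "x \<in> H \<Longrightarrow> g x \<in> H" by (rule aut_groupD)+
  qed
  let ?AM = "A\<lparr>carrier := M\<rparr>"
  interpret act: group_action ?AM H "\<lambda>g. restrict g H"
  proof (rule group_actionI)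
    show "group ?AM" by (rule A.subgroup_imp_group[OF M])
    show "g x \<in> H" if "g \<in> carrier ?AM" "x \<in> H" for g x
      using autM(2)[of g x] that by simp
  qed (simp_all add: A_mult)
  define O1 where "O1 = orbit ?AM (\<lambda>g. restrict g H) (rot 0)"
  have O1: "x \<in> O1 \<longleftrightarrow> (\<exists>g\<in>M. x = g (rot 0))" for x
    unfolding O1_def orbit_def using rot0 by auto
  have O1_H: "O1 \<subseteq> H"
  proof
    show "x \<in> H" if "x \<in> O1" for x
      using that autM(2)[OF _ rot0] unfolding O1 by blast
  qed
  have O1_C: "C \<subseteq> O1"
  proof
    fix c assume c: "c \<in> C"
    then have "c = \<rho> c (rot 0)" using rot0 C.mem_carrier by (simp add: \<rho> dihedral_one[symmetric])
    then show "c \<in> O1" using O1 R_M[OF c] by blast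
  qed
  have O1_mult: "x \<otimes>\<^bsub>G\<^esub> c \<in> O1" if x: "x \<in> O1" and c: "c \<in> C" for x c
  proof -
    obtain g where g: "g \<in> M" "x = g (rot 0)" using O1 x by blast
    have "\<rho> c \<otimes>\<^bsub>A\<^esub> g \<in> M" using R_M[OF c] g(1) by (rule M.m_closed)
    moreover have "(\<rho> c \<otimes>\<^bsub>A\<^esub> g) (rot 0) = x \<otimes>\<^bsub>G\<^esub> c"
      using g \<rho>[OF c, of x] O1_H x by (auto simp: A_mult)
    ultimately show ?thesis using O1 by metis
  qed
  \<comment> \<open>The orbit contains \<open>C\<close> and is closed under right multiplication by
    \<open>C\<close>, so it is \<open>C\<close> or all of \<open>H\<close>. In either case
    orbit-stabilizer leaves \<open>q\<close> dividing twice the order of the stabilizer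
    \<open>Z\<close>.\<close>
  have card_O1: "card O1 = N \<or> card O1 = 2 * N"
  proof (cases "\<exists>i. refl i \<in> O1")
    case False
    have "O1 \<subseteq> C"
    proof
      fix x assume x: "x \<in> O1"
      then have xH: "x \<in> H" using O1_H by blast
      show "x \<in> C" using H.mem_carrier[OF xH]
      proof (cases x rule: dihedral_cases)
        case (rot y) then show ?thesis using xH H(2) rotsub_simp[OF dn] by (simp add: C_def rot_part_def)
      next
        case (refl i) then show ?thesis using False x by blast
      qed
    qed
    then have "O1 = C" using O1_C by blast
    then show ?thesis using cC by simp
  next
    case True
    then obtain i where i: "refl i \<in> O1" by blast
    then have iH: "refl i \<in> H" using O1_H by blast
    have "H \<subseteq> O1"
      using card_subgroup_refl(2)[OF H n iH] O1_C O1_mult[OF i] unfolding C_def by blast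
    then have "O1 = H" using O1_H by blast
    then show ?thesis using card_subgroup_refl(3)[OF H n iH] by simp
  qed
  define Z where "Z = stabilizer ?AM (\<lambda>g. restrict g H) (rot 0)"
  have "card O1 * card Z = card M"
    using act.orbit_stabilizer_theorem[OF rot0] by (simp add: O1_def Z_def order_def)
  then have "q * N dvd card O1 * card Z" using cM by simp
  then have "q * N dvd N * (2 * card Z)" using card_O1 by (auto simp: ac_simps)
  then have "q dvd 2 * card Z" using N0 by (simp add: mult.commute)
  moreover have "\<not> q dvd 2" using odd_q q_gt_1 by (auto dest: dvd_imp_le simp: order_le_less)
  ultimately have qZ: "q dvd card Z" using prime_q prime_dvd_mult_iff by blast
  have Z: "subgroup Z ?AM" unfolding Z_def by (rule act.stabilizer_subgroup[OF rot0])
  have grpZ: "group (A\<lparr>carrier := Z\<rparr>)"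
    using group.subgroup_imp_group[OF A.subgroup_imp_group[OF M] Z] by simp
  have Z_M: "Z \<subseteq> M" using subgroup.subset[OF Z] by simp
  have "finite Z" using finite_subset[OF Z_M] finite_subset[OF M.subset finA] by blast
  then obtain z where z: "z \<in> Z" "z \<noteq> id" "z [^]\<^bsub>A\<lparr>carrier := Z\<rparr>\<^esub> q = id"
    using group.cauchy_element[OF grpZ _ prime_q] qZ A_mult by (auto simp: order_def)
  have zq: "z ^^ q = id" using z(3) aut_group_pow[of H "cay_arcs G S" z q] by (simp add: nat_pow_def A_def)
  have zM: "z \<in> M" using z(1) Z_M by blast
  have z0: "z (rot 0) = rot 0" using z(1) rot0 by (simp add: Z_def stabilizer_def)
  have zperm: "z permutes H" using autM(1)[OF zM] .
  have zinj: "inj z" using zperm permutes_inj by blast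
  have zH: "z x \<in> H" if "x \<in> H" for x using autM(2)[OF zM that] .
  have "\<exists>c'\<in>C. \<forall>x\<in>H. z (x \<otimes>\<^bsub>G\<^esub> c') = z x \<otimes>\<^bsub>G\<^esub> c" if c: "c \<in> C" for c
  proof -
    obtain c' where c': "c' \<in> C" "\<rho> c \<otimes>\<^bsub>A\<^esub> z = z \<otimes>\<^bsub>A\<^esub> \<rho> c'"
      using zM c unfolding M_def R_def by blast
    have "z (x \<otimes>\<^bsub>G\<^esub> c') = z x \<otimes>\<^bsub>G\<^esub> c" if x: "x \<in> H" for x
      using fun_cong[OF c'(2), of x] \<rho>[OF c zH[OF x]] \<rho>[OF c'(1) x] by (simp add: A_mult)
    then show ?thesis using c'(1) by blast
  qed
  then have eq: "\<exists>c'\<in>C. \<forall>x\<in>H. z (x \<otimes>\<^bsub>G\<^esub> c) = z x \<otimes>\<^bsub>G\<^esub> c'" if "c \<in> C" for c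
    using equivariant_swap[of C H z c] that finite_subset[OF C.subset finite_dihedral] C.subset rot0 zH H.mem_carrier
    by blast
  have shift: "\<exists>e. int n dvd int q * e \<and> z x = x \<otimes>\<^bsub>G\<^esub> rot e" if "x \<in> H" for x
    using normalizing_automorphism_shift[OF H n inj_on_subset[OF zinj subset_UNIV] zH z0 zq _ that] eq
    unfolding C_def by blast
  \<comment> \<open>Otherwise fixedness would spread from the identity along every arc, making
    \<open>z\<close> the identity on \<open>H\<close>.\<close>
  have "\<exists>w\<in>H. \<exists>s\<in>S. z w = w \<and> z (s \<otimes>\<^bsub>G\<^esub> w) \<noteq> s \<otimes>\<^bsub>G\<^esub> w"
  proof (rule ccontr)
    assume no: "\<not> ?thesis"
    have "z x = x" if "x \<in> H" for x
      using that unfolding H_def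
    proof (induction rule: reach.induct)
      case one then show ?case using z0 by (simp add: dihedral_one)
    next
      case (step x s) then show ?case using no unfolding H_def by blast
    qed
    then have "z = id" using permutes_not_in[OF zperm] by (auto simp: fun_eq_iff)
    then show False using z(2) by blast
  qed
  then obtain w s where w: "w \<in> H" "s \<in> S" "z w = w" "z (s \<otimes>\<^bsub>G\<^esub> w) \<noteq> s \<otimes>\<^bsub>G\<^esub> w" by blast
  define y where "y = s \<otimes>\<^bsub>G\<^esub> w"
  have SH: "S \<subseteq> H" unfolding H_def by (rule reach_generators[OF S(1)])
  have yH: "y \<in> H" using w SH by (auto simp: y_def)
  have sw: "s \<in> carrier G" "w \<in> carrier G" using w S by auto
  define Y where "Y = (\<lambda>l. (z ^^ l) y) ` {..<q}"
  have cY: "card Y = q"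
    unfolding Y_def using funpow_prime_orbit[OF zq zinj] w(4) by (simp add: card_image y_def)
  have zlH: "(z ^^ l) y \<in> H" for l by (induction l) (use yH zH in auto)
  have Y_shift: "\<exists>e. int n dvd int q * e \<and> (z ^^ l) y = y \<otimes>\<^bsub>G\<^esub> rot e" for l
  proof (induction l)
    case 0 then show ?case using H.mem_carrier[OF yH] by (intro exI[of _ 0]) (simp add: dihedral_one[symmetric])
  next
    case (Suc l)
    then obtain e where e: "int n dvd int q * e" "(z ^^ l) y = y \<otimes>\<^bsub>G\<^esub> rot e" by blast
    obtain e' where e': "int n dvd int q * e'" "z ((z ^^ l) y) = (z ^^ l) y \<otimes>\<^bsub>G\<^esub> rot e'"
      using shift[OF zlH] by blast
    have "int n dvd int q * (e + e')" using e(1) e'(1) by (simp add: distrib_left)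
    moreover have "(z ^^ Suc l) y = y \<otimes>\<^bsub>G\<^esub> rot (e + e')"
      using e(2) e'(2) H.mem_carrier[OF yH] by (simp add: m_assoc)
    ultimately show ?case by blast
  qed
  have "(w, (z ^^ l) y) \<in> cay_arcs G S" for l
  proof (induction l)
    case 0 then show ?case using w sw by (auto simp: cay_arcs_iff y_def)
  next
    case (Suc l)
    have "z \<in> carrier (aut_group H (cay_arcs G S))" using zM M.mem_carrier by (simp add: A_def)
    from aut_groupD(2)[OF this w(1) zlH[of l]] Suc show ?case using w(3) by simp
  qed
  then have "\<exists>s\<in>S. (z ^^ l) y = s \<otimes>\<^bsub>G\<^esub> w" for l using sw(2) by (simp add: cay_arcs_iff)
  then have Y_sub: "Y \<subseteq> (\<lambda>s. s \<otimes>\<^bsub>G\<^esub> w) ` S"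
    unfolding Y_def by (intro image_subsetI) (simp add: image_iff)
  have finS: "finite S" using S(1) finite_dihedral finite_subset by blast
  have cSw: "card ((\<lambda>s. s \<otimes>\<^bsub>G\<^esub> w) ` S) \<le> card S" using finS by (rule card_image_le)
  then have Y_eq: "Y = (\<lambda>s. s \<otimes>\<^bsub>G\<^esub> w) ` S"
    using finS Y_sub cY S(2) by (intro card_seteq) auto
  have "S \<subseteq> (\<lambda>\<kappa>. s \<otimes>\<^bsub>G\<^esub> \<kappa>) ` rot_q"
  proof
    fix s' assume s': "s' \<in> S"
    then have "s' \<otimes>\<^bsub>G\<^esub> w \<in> Y" using Y_eq by blast
    then obtain l where l: "s' \<otimes>\<^bsub>G\<^esub> w = (z ^^ l) y" unfolding Y_def by (elim imageE)
    obtain e where e: "int n dvd int q * e" "s' \<otimes>\<^bsub>G\<^esub> w = y \<otimes>\<^bsub>G\<^esub> rot e"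
      using Y_shift[of l] unfolding l by (elim exE conjE)
    \<comment> \<open>Moving the shift past \<open>w\<close> costs at most a sign, and
      \<open>rot_q\<close> is closed under inversion.\<close>
    obtain e' where e': "e' = e \<or> e' = - e" "w \<otimes>\<^bsub>G\<^esub> rot e = rot e' \<otimes>\<^bsub>G\<^esub> w"
      using rot_commute[OF sw(2)] by metis
    have "s' \<otimes>\<^bsub>G\<^esub> w = s \<otimes>\<^bsub>G\<^esub> rot e' \<otimes>\<^bsub>G\<^esub> w"
      using e(2) e'(2) sw by (simp add: y_def m_assoc)
    then have "s' = s \<otimes>\<^bsub>G\<^esub> rot e'" using subsetD[OF S(1) s'] sw by simp
    moreover have "rot e' \<in> rot_q" using e(1) e'(1) by (auto simp: rot_q_def)
    ultimately show "s' \<in> (\<lambda>\<kappa>. s \<otimes>\<^bsub>G\<^esub> \<kappa>) ` rot_q" by blast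
  qed
  moreover have "card ((\<lambda>\<kappa>. s \<otimes>\<^bsub>G\<^esub> \<kappa>) ` rot_q) \<le> card S"
    using card_image_le[OF card_rot_q(1), of "\<lambda>\<kappa>. s \<otimes>\<^bsub>G\<^esub> \<kappa>"] card_rot_q(2) cSw Y_eq cY by simp
  ultimately have "S = (\<lambda>\<kappa>. s \<otimes>\<^bsub>G\<^esub> \<kappa>) ` rot_q"
    using card_rot_q(1) by (intro card_seteq) auto
  then show thesis using that w(2) by blast
qed

end

section \<open>CI-subsets of size at most q\<close>

context dih_prime_power begin

text \<open>If \<open>C\<close> is a Sylow subgroup, its two copies in the automorphism group are conjugate,
  so the isomorphism may be chosen to normalize \<open>C\<close>, which makes it affine.\<close>

lemma small_stabilizer_imp_affine:
  assumes S: "S \<subseteq> carrier G" and T: "T \<subseteq> carrier G"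
    and rp: "rot_part d (reach G S)" "rot_part d (reach G T)" and n: "n = d * N"
    and f: "cay_iso_on G (reach G S) S (reach G T) T f"
    and nd: "\<not> q * N dvd order (aut_group (reach G S) (cay_arcs G S))"
  shows "\<exists>\<alpha>\<in>iso G G. \<alpha> ` S = T"
proof -
  define H where "H = reach G S"
  define H' where "H' = reach G T"
  define C where "C = rotsub d"
  define A where "A = aut_group H (cay_arcs G S)"
  have f: "cay_iso_on G H S H' T f" using f by (simp add: H_def H'_def)
  have H: "subgroup H G" "rot_part d H"
    using reach_subgroup[OF finite_dihedral S] rp by (simp_all add: H_def)
  have H': "subgroup H' G" "rot_part d H'"
    using reach_subgroup[OF finite_dihedral T] rp by (simp_all add: H'_def)
  interpret H: subgroup H G by (rule H)
  interpret H': subgroup H' G by (rule H')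
  interpret A: group A unfolding A_def by (rule group_aut_group)
  have dn: "int d dvd int n" using n by simp
  have N0: "N > 0" using n n_ge_3 by (auto intro: Nat.gr0I)
  have finH: "finite H" using H.subset finite_dihedral finite_subset by blast
  have finA: "finite (carrier A)" unfolding A_def by (rule finite_aut_group[OF finH])
  have A_mult: "x \<otimes>\<^bsub>A\<^esub> y = x \<circ> y" for x y by (simp add: A_def)
  have CH: "C \<subseteq> H" using H(2) by (auto simp: C_def rotsub_def rot_part_def)
  have CH': "C \<subseteq> H'" using H'(2) by (auto simp: C_def rotsub_def rot_part_def)
  have C: "subgroup C G" unfolding C_def by (rule rotsub_subgroup)
  interpret C: subgroup C G by (rule C)
  have finC: "finite C" using finite_subset[OF C.subset finite_dihedral] .
  have cC: "card C = N" unfolding C_def by (rule card_rotsub[OF n])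
  have rot0: "rot 0 \<in> H" using H.one_closed by (simp add: dihedral_one)
  have neH: "H \<noteq> {}" using rot0 by blast
  have id: "cay_iso_on G H S H S (\<lambda>x. x)" by (simp add: cay_iso_on_def bij_betw_def)
  define R where "R = pulled G H (\<lambda>x. x) ` C"
  define R' where "R' = pulled G H f ` C"
  have R: "subgroup R A" "card R = N"
    unfolding R_def A_def using pulled_subgroup[OF id finH neH H(1) S C CH] cC by auto
  have R': "subgroup R' A" "card R' = N"
    unfolding R'_def A_def using pulled_subgroup[OF f finH neH H'(1) T C CH'] cC by auto
  obtain j where j: "N = q ^ j" using divisor_of_n(1)[OF n] by blast
  \<comment> \<open>Here \<open>nd\<close> says that \<open>R\<close> is a Sylow subgroup of
    \<open>A\<close>, so some \<open>g\<close> conjugates the pulled-back copy \<open>R'\<close>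
    into \<open>R\<close>.\<close>
  have "\<not> q * card R dvd order A" using nd by (simp add: R(2) A_def H_def)
  then obtain g where g: "g \<in> carrier A" "\<And>r. r \<in> R' \<Longrightarrow> \<exists>k\<in>R. r \<otimes>\<^bsub>A\<^esub> g = g \<otimes>\<^bsub>A\<^esub> k"
    using A.p_subgroup_conjugate[OF finA R'(1) R(1) prime_q, of j] R'(2) j by metis
  have gH: "g x \<in> H" if "x \<in> H" for x
    using aut_groupD(3)[OF _ that] g(1) unfolding A_def by blast
  define h where "h = f \<circ> g"
  have h: "cay_iso_on G H S H' T h"
    unfolding h_def using g(1) by (intro cay_iso_on_comp[OF cay_iso_on_aut f]) (simp add: A_def)
  have hG: "h x \<in> carrier G" if "x \<in> H" for x using cay_iso_onD(3)[OF h that] by simp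
  have "\<exists>c'\<in>C. \<forall>x\<in>H. h (x \<otimes>\<^bsub>G\<^esub> c') = h x \<otimes>\<^bsub>G\<^esub> c" if c: "c \<in> C" for c
  proof -
    obtain c' where c': "c' \<in> C" "pulled G H f c \<otimes>\<^bsub>A\<^esub> g = g \<otimes>\<^bsub>A\<^esub> pulled G H (\<lambda>x. x) c'"
      using g(2) c unfolding R_def R'_def by blast
    have "h (x \<otimes>\<^bsub>G\<^esub> c') = h x \<otimes>\<^bsub>G\<^esub> c" if x: "x \<in> H" for x
    proof -
      have "pulled G H (\<lambda>x. x) c' x = x \<otimes>\<^bsub>G\<^esub> c'" using x c'(1) CH by (intro pulled_id) auto
      then have "g (x \<otimes>\<^bsub>G\<^esub> c') = inv_into H f (f (g x) \<otimes>\<^bsub>G\<^esub> c)"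
        using fun_cong[OF c'(2), of x] gH[OF x] by (simp add: A_mult pulled_def[of G H f])
      moreover have "f (g x) \<otimes>\<^bsub>G\<^esub> c \<in> H'"
        using cay_iso_onD(3)[OF f gH[OF x]] c CH' by (intro H'.m_closed) auto
      ultimately show ?thesis
        using cay_iso_onD(1)[OF f] by (simp add: h_def bij_betw_inv_into_right)
    qed
    then show ?thesis using c'(1) by blast
  qed
  then have h_eq: "\<exists>c'\<in>C. \<forall>x\<in>H. h (x \<otimes>\<^bsub>G\<^esub> c) = h x \<otimes>\<^bsub>G\<^esub> c'" if "c \<in> C" for c
    using equivariant_swap[of C H h c] that finC C.subset neH hG by blast
  \<comment> \<open>The conjugating \<open>g\<close> may move the identity. Translating back by
    \<open>w\<close> preserves equivariance, since \<open>w\<close> conjugates each rotation to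
    itself or its inverse.\<close>
  define w where "w = inv\<^bsub>G\<^esub> h (rot 0)"
  have w: "w \<in> H'" unfolding w_def using cay_iso_onD(3)[OF h rot0] by simp
  define h2 where "h2 = (\<lambda>x. x \<otimes>\<^bsub>G\<^esub> w) \<circ> h"
  have h2: "cay_iso_on G H S H' T h2"
    unfolding h2_def by (rule cay_iso_on_comp[OF h cay_iso_on_mult_right[OF H'(1) T w]])
  have h2H': "h2 x \<in> H'" if "x \<in> H" for x using cay_iso_onD(3)[OF h2 that] .
  have h2_0: "h2 (rot 0) = rot 0" using hG[OF rot0] by (simp add: h2_def w_def dihedral_one)
  have h2_eq: "\<exists>c'\<in>C. \<forall>x\<in>H. h2 (x \<otimes>\<^bsub>G\<^esub> c) = h2 x \<otimes>\<^bsub>G\<^esub> c'" if c: "c \<in> C" for c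
  proof -
    obtain c' where c': "c' \<in> C" "\<forall>x\<in>H. h (x \<otimes>\<^bsub>G\<^esub> c) = h x \<otimes>\<^bsub>G\<^esub> c'" using h_eq[OF c] by blast
    obtain e where e: "c' = rot e" "int d dvd e" using c'(1) by (auto simp: C_def rotsub_def)
    obtain e' where e': "e' = e \<or> e' = - e" "w \<otimes>\<^bsub>G\<^esub> rot e = rot e' \<otimes>\<^bsub>G\<^esub> w"
        "rot e \<otimes>\<^bsub>G\<^esub> w = w \<otimes>\<^bsub>G\<^esub> rot e'"
      by (rule rot_commute[OF H'.mem_carrier[OF w], of e])
    have "rot e' \<in> C" using e(2) e'(1) by (auto simp: C_def rotsub_def)
    moreover have "h2 (x \<otimes>\<^bsub>G\<^esub> c) = h2 x \<otimes>\<^bsub>G\<^esub> rot e'" if x: "x \<in> H" for x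
      using c'(2) x e'(3) w hG[OF x] by (simp add: h2_def e(1) m_assoc)
    ultimately show ?thesis by blast
  qed
  obtain u where u: "\<And>x y. x \<in> H \<Longrightarrow> int d dvd y \<Longrightarrow> h2 (x \<otimes>\<^bsub>G\<^esub> rot y) = h2 x \<otimes>\<^bsub>G\<^esub> rot (u * y)"
    using equivariant_linear[OF H dn _ h2_eq[unfolded C_def]] h2H' H'.mem_carrier by metis
  have h2_rot: "h2 (rot y) = rot (u * y)" if "int d dvd y" for y
    using u[OF rot0 that] h2_0 by simp
  have inj: "inj_on h2 H" using cay_iso_onD(1)[OF h2] by (simp add: bij_betw_def)
  \<comment> \<open>A multiplier divisible by \<open>q\<close> would collapse the rotations of order
    \<open>q\<close>, against injectivity. If \<open>N = 1\<close> there are none, and all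
    multipliers agree on the trivial rotation part, so 1 is chosen.\<close>
  have "\<exists>v. coprime v (int n) \<and> (\<forall>y. int d dvd y \<longrightarrow> rot (u * y) = rot (v * y))"
  proof (cases "N = 1")
    case True
    have "rot (u * y) = rot (1 * y)" if "int d dvd y" for y
    proof -
      have "int n dvd y" using that n True by simp
      then show ?thesis unfolding rot_eq_iff by (intro dvd_diff dvd_mult)
    qed
    then show ?thesis by (intro exI[of _ 1]) simp
  next
    case False
    then obtain N' where N': "N = q * N'" using divisor_of_n(2)[OF n] by blast
    have "\<not> int q dvd u"
    proof
      assume "int q dvd u"
      then obtain u' where "u = int q * u'" by blast
      then have "int n dvd u * int (d * N')" by (simp add: n N' ac_simps)
      then have "h2 (rot (int (d * N'))) = h2 (rot 0)"
        using h2_rot[of "int (d * N')"] h2_0 by (simp add: rot_eq_iff)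
      moreover have "rot (int (d * N')) \<in> H" using H(2) by (simp add: rot_part_def)
      ultimately have "rot (int (d * N')) = rot 0" using inj rot0 by (auto dest: inj_onD)
      then have "n dvd d * N'" by (simp add: rot_eq_iff flip: of_nat_mult)
      moreover have "0 < d * N'" "d * N' < n" using n N' n_ge_3 q_gt_1 by (auto intro: Nat.gr0I)
      ultimately show False using dvd_imp_le by fastforce
    qed
    then show ?thesis using coprime_n by blast
  qed
  then obtain v where v: "coprime v (int n)" "\<And>y. int d dvd y \<Longrightarrow> rot (u * y) = rot (v * y)" by blast
  have h2_rot': "h2 (rot y) = rot (v * y)" if "int d dvd y" for y using h2_rot[OF that] v(2)[OF that] by simp
  have "\<exists>b. \<forall>x\<in>H. h2 x = affine v b x"
  proof (cases "\<exists>i. refl i \<in> H")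
    case False
    have "h2 x = affine v 0 x" if x: "x \<in> H" for x
      using H.mem_carrier[OF x]
    proof (cases x rule: dihedral_cases)
      case (rot y) then show ?thesis using x H(2) h2_rot' by (simp add: rot_part_def)
    next
      case (refl i) then show ?thesis using x False by blast
    qed
    then show ?thesis by blast
  next
    case True
    then obtain i where i: "refl i \<in> H" by blast
    obtain i' where i': "h2 (refl i) = refl i'"
      using image_refl[OF H H'.subset H'(2) dn inj h2H' h2_rot' i] by blast
    have "h2 x = affine v (i' - v * i) x" if x: "x \<in> H" for x
      using H.mem_carrier[OF x]
    proof (cases x rule: dihedral_cases)
      case (rot y) then show ?thesis using x H(2) h2_rot' by (simp add: rot_part_def)
    next
      case (refl j)
      then have dij: "int d dvd i - j" using subgroup_refl_iff[OF H i] x by simp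
      have "h2 (refl i \<otimes>\<^bsub>G\<^esub> rot (i - j)) = refl i' \<otimes>\<^bsub>G\<^esub> rot (v * (i - j))"
        using u[OF i dij] unfolding v(2)[OF dij] i' .
      then show ?thesis using refl by (simp add: algebra_simps)
    qed
    then show ?thesis by blast
  qed
  then obtain b where b: "\<And>x. x \<in> H \<Longrightarrow> h2 x = affine v b x" by blast
  have SH: "S \<subseteq> H" unfolding H_def by (rule reach_generators[OF S])
  have TH: "T \<subseteq> H'" unfolding H'_def by (rule reach_generators[OF T])
  have "h2 ` S = T"
    by (rule cay_iso_on_generators[OF h2 _ _ S SH T TH]) (use h2_0 rot0 in \<open>simp_all add: dihedral_one\<close>)
  moreover have "affine v b ` S = h2 ` S" using b SH by (intro image_cong) auto
  ultimately show ?thesis using affine_iso[OF v(1)] by blast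
qed

text \<open>In the cyclic \<open>q\<close>-group of rotations every nontrivial subgroup contains
  \<open>Q\<close>, so the coset of \<open>rot i\<close> generates the same subgroup as
  \<open>rot i\<close> alone.\<close>

lemma rot_coset_generated:
  assumes S: "S = (\<lambda>\<kappa>. rot i \<otimes>\<^bsub>G\<^esub> \<kappa>) ` rot_q" "rot 0 \<notin> S" and rp: "rot_part d (reach G S)"
  shows "int d = gcd i (int n)" "\<not> int n dvd i"
proof -
  have SG: "S \<subseteq> carrier G" using S by (auto simp: rot_q_def)
  have qi: "\<not> int n dvd int q * i"
  proof
    assume "int n dvd int q * i"
    then have "rot (- i) \<in> rot_q" by (simp add: rot_q_def)
    then have "rot i \<otimes>\<^bsub>G\<^esub> rot (- i) \<in> S" using S(1) by blast
    then show False using S(2) by simp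
  qed
  then show "\<not> int n dvd i" by (metis dvd_mult)
  have "rot i \<otimes>\<^bsub>G\<^esub> rot 0 \<in> S" unfolding S(1) by (rule imageI) (simp add: rot_q_def)
  then have "rot i \<in> reach G S" using reach_generators[OF SG] by auto
  then have di: "int d dvd i" using rp by (simp add: rot_part_def)
  have "rot (int n) \<in> reach G S" using reach.one[of G S] rot_eq_iff[of "int n" 0] by (simp add: dihedral_one)
  then have dn: "int d dvd int n" using rp unfolding rot_part_def by blast
  obtain j where j: "gcd i (int n) = int q ^ j" "j \<le> k"
  proof -
    have "nat (gcd i (int n)) dvd q ^ k" using n_eq by (metis gcd_dvd2 gcd_ge_0_int int_dvd_int_iff int_nat_eq of_nat_power)
    then obtain j where "j \<le> k" "nat (gcd i (int n)) = q ^ j" using divides_primepow_nat[OF prime_q] by blast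
    then show thesis using that[of j] by (metis gcd_ge_0_int int_nat_eq of_nat_power)
  qed
  have "j \<noteq> k"
  proof
    assume "j = k"
    then have "int n dvd i" using j n_eq by (metis gcd_dvd1 of_nat_power)
    then show False using qi by simp
  qed
  then have jk: "j < k" using j by simp
  have gcd_e: "gcd i (int n) dvd e" if "int n dvd int q * e" for e
  proof -
    obtain k' where k': "k = Suc k'" using jk by (cases k) auto
    have "int q * int q ^ k' dvd int q * e" using that n_eq k' by simp
    then have "int q ^ k' dvd e" using q_gt_1 by simp
    moreover have "int q ^ j dvd int q ^ k'" using jk k' by (intro le_imp_power_dvd) simp
    ultimately show ?thesis using j dvd_trans by metis
  qed
  have "subgroup (rotsub (nat (gcd i (int n)))) G" by (rule rotsub_subgroup)
  moreover have "S \<subseteq> rotsub (nat (gcd i (int n)))"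
    using gcd_e by (auto simp: S(1) rot_q_def rotsub_def)
  ultimately have sub: "reach G S \<subseteq> rotsub (nat (gcd i (int n)))" by (rule reach_least)
  have "rot (int d) \<in> reach G S" using rp by (simp add: rot_part_def)
  then have "rot (int d) \<in> rotsub (nat (gcd i (int n)))" using sub by blast
  then have "gcd i (int n) dvd int d" by (subst (asm) rotsub_simp) simp_all
  moreover have "int d dvd gcd i (int n)" using di dn by simp
  ultimately show "int d = gcd i (int n)" by (metis abs_of_nat gcd_ge_0_int abs_of_nonneg zdvd_antisym_abs)
qed

text \<open>Affine maps preserve \<open>Q\<close>, so matching one representative suffices. Two
  reflections differ by a translation of exponents; two rotations have the same gcd \<open>d\<close>
  with \<open>n\<close>, so a unit multiplier relates them. The mixed case is excluded by
  \<open>refl_iff\<close>.\<close>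

lemma coset_imp_equivalent:
  assumes S: "S = (\<lambda>\<kappa>. s \<otimes>\<^bsub>G\<^esub> \<kappa>) ` rot_q" "conn_set G S" "s \<in> S"
    and T: "T = (\<lambda>\<kappa>. t \<otimes>\<^bsub>G\<^esub> \<kappa>) ` rot_q" "conn_set G T" "t \<in> T"
    and rp: "rot_part d (reach G S)" "rot_part d (reach G T)" and card: "card S = card T"
    and refl_iff: "(\<exists>i. refl i \<in> reach G S) \<longleftrightarrow> (\<exists>i. refl i \<in> reach G T)"
  shows "\<exists>\<alpha>\<in>iso G G. \<alpha> ` S = T"
proof -
  have SG: "S \<subseteq> carrier G" "T \<subseteq> carrier G" and nS: "rot 0 \<notin> S" "rot 0 \<notin> T"
    using S(2) T(2) by (auto simp: conn_set_def dihedral_one)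
  have finT: "finite T" using SG finite_dihedral finite_subset by blast
  have suffices: ?thesis if \<alpha>: "\<alpha> \<in> iso G G" "\<alpha> ` S \<subseteq> T" for \<alpha>
  proof -
    have "inj_on \<alpha> S" using \<alpha>(1) SG by (auto simp: iso_def bij_betw_def intro: inj_on_subset)
    then have "card (\<alpha> ` S) = card T" using card by (simp add: card_image)
    then have "\<alpha> ` S = T" using card_subset_eq[OF finT \<alpha>(2)] by simp
    then show ?thesis using \<alpha>(1) by blast
  qed
  have no_refl: "\<nexists>i. refl i \<in> reach G U" if "U = (\<lambda>\<kappa>. rot j \<otimes>\<^bsub>G\<^esub> \<kappa>) ` rot_q" for U j
  proof -
    have "U \<subseteq> rotsub 1" using that by (auto simp: rot_q_def rotsub_def)
    then have "reach G U \<subseteq> rotsub 1" using reach_least rotsub_subgroup by blast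
    then show ?thesis by (auto simp: rotsub_def)
  qed
  have sG: "s \<in> carrier G" "t \<in> carrier G" using S(3) T(3) SG by auto
  have srefl: "refl i \<in> reach G S" if "s = refl i" for i
    using reach_generators[OF SG(1)] S(3) that by blast
  have trefl: "refl i \<in> reach G T" if "t = refl i" for i
    using reach_generators[OF SG(2)] T(3) that by blast
  show ?thesis using sG(1)
  proof (cases s rule: dihedral_cases)
    case s: (refl i)
    show ?thesis using sG(2)
    proof (cases t rule: dihedral_cases)
      case (rot j)
      then show ?thesis using no_refl[of T j] T(1) refl_iff srefl[OF s] by blast
    next
      case t: (refl i')
      have "affine 1 (i' - i) ` S \<subseteq> T"
        unfolding S(1) T(1) s t rot_q_def by (auto simp: image_iff)
      then show ?thesis using suffices[OF affine_iso[of 1 "i' - i"]] by simp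
    qed
  next
    case s: (rot i)
    show ?thesis using sG(2)
    proof (cases t rule: dihedral_cases)
      case (refl j)
      then show ?thesis using no_refl[of S i] S(1) refl_iff trefl[OF refl] s by blast
    next
      case t: (rot i')
      have gi: "int d = gcd i (int n)" "\<not> int n dvd i"
        using rot_coset_generated[OF _ nS(1) rp(1)] S(1) s by auto
      have gi': "int d = gcd i' (int n)" "\<not> int n dvd i'"
        using rot_coset_generated[OF _ nS(2) rp(2)] T(1) t by auto
      have d0: "int d > 0" using gi(1) n_pos gcd_pos_int[of i "int n"] by simp
      \<comment> \<open>The quotients of \<open>x\<close> and \<open>n\<close> by their gcd are
        coprime and \<open>q\<close> divides the second one, so \<open>q\<close> does not divide the
        first.\<close>
      have cop: "coprime (x div int d) (int n)" if x: "int d = gcd x (int n)" "\<not> int n dvd x" for x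
      proof (rule coprime_n)
        show "\<not> int q dvd x div int d"
        proof
          assume qx: "int q dvd x div int d"
          have cop: "coprime (x div int d) (int n div int d)"
            unfolding x(1) using n_pos by (intro div_gcd_coprime) simp
          have dn: "int d dvd int n" "int d dvd x" using x(1) by simp_all
          then have "d dvd n" by simp
          then obtain N where N: "n = d * N" by (rule dvdE)
          have "N \<noteq> 1"
          proof
            assume "N = 1"
            then show False using x(2) dn(2) N by simp
          qed
          then have "q dvd N" using divisor_of_n(2)[OF N] by blast
          moreover have "int n div int d = int N" using N d0 by simp
          ultimately have "int q dvd int n div int d" by simp
          then have "is_unit (int q)" using cop qx coprime_common_divisor by blast
          then show False using q_gt_1 by simp
        qed
      qed
      define i1 where "i1 = i div int d"
      define i1' where "i1' = i' div int d"
      have i1: "coprime i1 (int n)" "i = int d * i1"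
        unfolding i1_def using cop[OF gi] gi(1) by simp_all
      have i1': "coprime i1' (int n)" "i' = int d * i1'"
        unfolding i1'_def using cop[OF gi'] gi'(1) by simp_all
      obtain c where c: "[i1 * c = 1] (mod int n)" using cong_solve_coprime_int[OF i1(1)] by blast
      then have c': "[c * i1 = 1] (mod int n)" by (simp add: mult.commute)
      then have cc: "coprime c (int n)" using coprime_iff_invertible_int by blast
      define u where "u = i1' * c"
      have cu: "coprime u (int n)" unfolding u_def using i1'(1) cc by simp
      have "[i1' * (c * i1) = i1' * 1] (mod int n)" using c' by (rule cong_scalar_left)
      then have "[int d * (i1' * (c * i1)) = int d * i1'] (mod int n)" by (intro cong_scalar_left) simp
      then have ui: "[u * i = i'] (mod int n)" by (simp add: u_def i1(2) i1'(2) ac_simps)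
      have "affine u 0 ` S \<subseteq> T"
      proof (intro image_subsetI)
        fix x assume "x \<in> S"
        then obtain e where e: "x = rot (i + e)" "int n dvd int q * e" by (auto simp: S(1) s rot_q_def)
        have "affine u 0 x = rot (u * i + u * e)" using e by (simp add: distrib_left)
        also have "\<dots> = rot (i' + u * e)" using ui by (simp add: rot_eq_iff cong_iff_dvd_diff)
        also have "\<dots> = rot i' \<otimes>\<^bsub>G\<^esub> rot (u * e)" by simp
        finally have x: "affine u 0 x = rot i' \<otimes>\<^bsub>G\<^esub> rot (u * e)" .
        have "rot (u * e) \<in> rot_q" unfolding rot_q_def using e(2) by (intro imageI) (simp add: mult.left_commute)
        then show "affine u 0 x \<in> T" unfolding x T(1) t by (rule imageI)
      qed
      then show ?thesis using suffices[OF affine_iso[OF cu]] by simp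
    qed
  qed
qed

lemma CI_subset_small:
  assumes S: "conn_set G S" "card S \<le> q"
  shows "CI_subset G S"
  unfolding CI_subset_def
proof (intro allI impI; elim conjE)
  fix T assume T: "conn_set G T" and "cay_iso G S T"
  have SG: "S \<subseteq> carrier G" "T \<subseteq> carrier G" using S(1) T by (auto simp: conn_set_def)
  obtain f where f: "cay_iso_on G (reach G S) S (reach G T) T f" "f \<one>\<^bsub>G\<^esub> = \<one>\<^bsub>G\<^esub>"
    using cay_iso_reach[OF \<open>cay_iso G S T\<close> SG] .
  have H: "subgroup (reach G S) G" and H': "subgroup (reach G T) G"
    using reach_subgroup[OF finite_dihedral] SG by blast+
  have fin: "finite (reach G S)" "finite (reach G T)"
    using H H' subgroup.subset finite_dihedral finite_subset by metis+
  obtain d N where d: "n = d * N" "rot_part d (reach G S)" using subgroup_rot_part[OF H] .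
  obtain d' N' where d': "n = d' * N'" "rot_part d' (reach G T)" using subgroup_rot_part[OF H'] .
  have card_reach: "card (reach G S) = card (reach G T)"
    using cay_iso_onD(1)[OF f(1)] by (rule bij_betw_same_card)
  have card_cases: "card K = (if \<exists>i. refl i \<in> K then 2 * M else M)" if "subgroup K G" "rot_part e K" "n = e * M" for K e M
    using card_subgroup_refl(1,3)[OF that] card_rotsub[OF that(3)] by auto
  have "odd n" using odd_q n_eq by simp
  then have odd: "odd N" "odd N'" using d(1) d'(1) by (metis even_mult_iff)+
  \<comment> \<open>The order of a component is \<open>N\<close> or \<open>2 * N\<close> with
    \<open>N\<close> odd, so its parity reveals whether reflections occur and then determines
    \<open>N\<close>.\<close>
  have eq: "N = N'" and refl: "(\<exists>i. refl i \<in> reach G S) \<longleftrightarrow> (\<exists>i. refl i \<in> reach G T)"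
    using card_reach odd unfolding card_cases[OF H d(2,1)] card_cases[OF H' d'(2,1)]
    by (auto split: if_splits)
  have "N > 0" using d(1) n_ge_3 by (auto intro: Nat.gr0I)
  then have dd: "d' = d" using d(1) d'(1) eq by simp
  have fST: "f ` S = T"
    by (rule cay_iso_on_generators[OF f(1,2) reach.one SG(1) reach_generators[OF SG(1)] SG(2) reach_generators[OF SG(2)]])
  have "inj_on f S"
    using cay_iso_onD(1)[OF f(1)] reach_generators[OF SG(1)] by (auto simp: bij_betw_def intro: inj_on_subset)
  then have card: "card S = card T" using card_image[of f S] by (simp add: fST)
  show "\<exists>\<alpha>\<in>iso G G. \<alpha> ` S = T"
  proof (cases "q * N dvd order (aut_group (reach G S) (cay_arcs G S))")
    case False
    then show ?thesis
      using small_stabilizer_imp_affine[OF SG d(2) _ d(1) f(1)] d'(2) dd by simp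
  next
    case True
    obtain s where s: "s \<in> S" "S = (\<lambda>\<kappa>. s \<otimes>\<^bsub>G\<^esub> \<kappa>) ` rot_q"
      using large_stabilizer_imp_coset[OF SG(1) S(2) d(2,1) True] .
    \<comment> \<open>Both components have automorphism groups of the same order, so the exceptional
      case applies to \<open>S\<close> and \<open>T\<close> together.\<close>
    have "q * N' dvd order (aut_group (reach G T) (cay_arcs G T))"
      using True order_aut_group_eq[OF f(1) fin] eq by simp
    then obtain t where t: "t \<in> T" "T = (\<lambda>\<kappa>. t \<otimes>\<^bsub>G\<^esub> \<kappa>) ` rot_q"
      using large_stabilizer_imp_coset[OF SG(2) _ d'(2,1)] S(2) card by metis
    show ?thesis
      using coset_imp_equivalent[OF s(2) S(1) s(1) t(2) T t(1) d(2) _ card refl] d'(2) dd by simp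
  qed
qed

end

section \<open>The m-DCI property\<close>

lemma (in group) prime_order_iso_integer_mod_group:
  assumes p: "Factorial_Ring.prime (order G)"
  shows "G \<cong> integer_mod_group (order G)"
proof -
  let ?p = "order G"
  have p0: "?p > 1" using p prime_gt_1_nat by blast
  then have fin: "finite (carrier G)" using order_gt_0_iff_finite by simp
  have "carrier G \<noteq> {\<one>}" using p0 by (auto simp: order_def)
  then obtain x where x: "x \<in> carrier G" "x \<noteq> \<one>" using one_closed by blast
  have "ord x dvd ?p" using x by (rule_tac ord_dvd_group_order)
  moreover have "ord x \<noteq> 1" using x ord_eq_1 by blast
  ultimately have ord: "ord x = ?p" using p by (auto simp: prime_nat_iff)
  define f where "f = (\<lambda>i::int. x [^] i)"
  have carr: "carrier (integer_mod_group ?p) = {0..<int ?p}" using p0 by (simp add: carrier_integer_mod_group)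
  have hom: "f \<in> hom (integer_mod_group ?p) G"
  proof (rule homI)
    fix i j :: int
    have "f ((i + j) mod int ?p) = f (i + j)"
      using x ord by (simp add: f_def int_pow_eq mod_eq_dvd_iff[symmetric])
    then show "f (i \<otimes>\<^bsub>integer_mod_group ?p\<^esub> j) = f i \<otimes> f j" using x by (simp add: f_def int_pow_mult)
  qed (use x in \<open>simp add: f_def\<close>)
  have inj: "inj_on f {0..<int ?p}"
  proof (rule inj_onI)
    fix i j assume ij: "i \<in> {0..<int ?p}" "j \<in> {0..<int ?p}" "f i = f j"
    have "int ?p dvd i - j"
      using x ord ij(3) by (simp add: f_def int_pow_eq dvd_diff_commute)
    then have "i mod int ?p = j mod int ?p" by (simp only: mod_eq_dvd_iff)
    then show "i = j" using ij(1,2) by simp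
  qed
  have "f ` {0..<int ?p} = carrier G"
    using x card_image[OF inj] fin by (intro card_subset_eq) (auto simp: f_def order_def)
  then have "f \<in> iso (integer_mod_group ?p) G"
    using hom inj by (simp add: iso_def bij_betw_def carr)
  then have "integer_mod_group ?p \<cong> G" by (auto simp: is_iso_def)
  then show ?thesis by (rule group.iso_sym[OF group_integer_mod_group])
qed

context dih begin

lemma DCI_imp_odd:
  assumes "1 \<le> m" "m \<le> n - 1" "has_DCI G m"
  shows "odd n"
proof (cases "m = 1")
  case True then show ?thesis using even_not_1_DCI assms(3) by blast
next
  case False then show ?thesis using even_not_DCI[of m] assms by auto
qed

text \<open>As \<open>n\<close> is odd, so is \<open>p\<close>, and doubling \<open>n\<close> does
  not change the multiplicity of \<open>p\<close>; hence a Sylow subgroup has prime order.\<close>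

lemma DCI_imp_sylow_prime_order:
  assumes m: "1 \<le> m" "m \<le> n - 1" "has_DCI G m"
    and p: "Factorial_Ring.prime p" "p dvd n" "p + 1 \<le> m" and P: "sylow_subgroup G p P"
  shows "G\<lparr>carrier := P\<rparr> \<cong> integer_mod_group p"
proof -
  have n: "odd n" using DCI_imp_odd m by blast
  have "\<not> p ^ 2 dvd n" using square_dvd_not_DCI[OF n p(1) _ p(3) m(2)] m(3) by blast
  moreover have "coprime (p ^ 2) 2"
    using n p(2) by auto
  ultimately have "\<not> p ^ 2 dvd 2 * n" by (simp add: coprime_dvd_mult_right_iff)
  moreover have "p ^ 1 dvd 2 * n" using p(2) by simp
  ultimately have "multiplicity p (2 * n) = 1"
    by (intro multiplicity_eqI) (simp_all add: numeral_2_eq_2)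
  then have P: "subgroup P G" "card P = p"
    using P by (simp_all add: sylow_subgroup_def order_dihedral)
  interpret P: group "G\<lparr>carrier := P\<rparr>" using P(1) by (rule subgroup_imp_group)
  have "order (G\<lparr>carrier := P\<rparr>) = p" using P(2) by (simp add: order_def)
  then show ?thesis using P.prime_order_iso_integer_mod_group p(1) by simp
qed

lemma prime_power_DCI_iff:
  assumes q: "Factorial_Ring.prime q" "n = q ^ k" and m: "1 \<le> m" "m \<le> n - 1"
  shows "has_DCI G m \<longleftrightarrow> odd q \<and> (n = q \<or> m \<le> q)"
proof
  assume DCI: "has_DCI G m"
  have odd: "odd n" using DCI_imp_odd m DCI by blast
  have k: "k \<noteq> 0" using q(2) n_ge_3 by (intro notI) simp
  then have "odd q" using odd q(2) by simp
  moreover have "n = q \<or> m \<le> q"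
  proof (rule ccontr)
    assume "\<not> ?thesis"
    then have "n \<noteq> q" "q + 1 \<le> m" by auto
    then have "2 \<le> k" using k q(2) by (cases "k = 1") auto
    then have "q ^ 2 dvd n" unfolding q(2) by (rule le_imp_power_dvd)
    then show False using square_dvd_not_DCI[OF odd q(1) _ \<open>q + 1 \<le> m\<close> m(2)] DCI by blast
  qed
  ultimately show "odd q \<and> (n = q \<or> m \<le> q)" by blast
next
  assume *: "odd q \<and> (n = q \<or> m \<le> q)"
  then interpret dih_prime_power n q k using q by unfold_locales auto
  \<comment> \<open>When \<open>n = q\<close>, the bound \<open>m \<le> n - 1\<close> already gives
    \<open>m \<le> q\<close>.\<close>
  show "has_DCI G m" using CI_subset_small * m(2) by (auto simp: has_DCI_def)
qed

end

theorem theorem1p1: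
  fixes n :: nat
  assumes "n \<ge> 3"
  shows "(\<forall>m. 1 \<le> m \<and> m \<le> n - 1 \<and> has_DCI (dihedral n) m \<longrightarrow>
            odd n \<and>
            (\<forall>p. Factorial_Ring.prime p \<and> p dvd n \<and> p + 1 \<le> m \<longrightarrow>
               (\<forall>P. sylow_subgroup (dihedral n) p P \<longrightarrow>
                  (dihedral n)\<lparr>carrier := P\<rparr> \<cong> integer_mod_group p)))
       \<and> (\<forall>q k. Factorial_Ring.prime q \<and> n = q ^ k \<longrightarrow>
            (\<forall>m. 1 \<le> m \<and> m \<le> n - 1 \<longrightarrow>
               (has_DCI (dihedral n) m \<longleftrightarrow> odd q \<and> (n = q \<or> m \<le> q))))"
proof -
  interpret dih n using assms by unfold_locales
  show ?thesis
    using DCI_imp_odd DCI_imp_sylow_prime_order prime_power_DCI_iff by blast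
qed

end
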